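(* Let $(P,\lesssim)$ be a preordered set and let $\mathscr{A}$ be a complete category. Then the category $\mathrm{Cell}(P,\mathscr{A})$ of $\mathscr{A}$-valued cellular sheaves on $P$ and the category $\mathrm{Sh}(P,\mathscr{A})$ of $\mathscr{A}$-valued sheaves on $P$ (with the Alexandrov topology) are equivalent categories.
   Context: A preordered set $(P,\lesssim)$ is regarded as a category with exactly one morphism $x\to y$ when $x\lesssim y$ and none otherwise. $\mathrm{Cell}(P,\mathscr{A})$ is the full subcategory of the functor category $[P,\mathscr{A}]$ on those functors $F$ (called $\mathscr{A}$-valued cellular sheaves on $P$) such that whenever $x\lesssim y$ and $y\lesssim x$ one has $F(x)=F(y)$ and $F(x\lesssim y)=F(y\lesssim x)=\mathrm{Id}_{F(x)}$; morphisms are natural transformations. For $p\in P$ put $U_p:=\{q\in P\mid q\gtrsim p\}$. The sets $U_p$ form a base of a topology on $P$, the Alexandrov topology; $P$ carries this topology. *)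

theory Defs
  imports "HOL-Analysis.Abstract_Topology" "HOL-Library.Equipollence" "HOL-Library.FuncSet"
begin

section \<open>Categories, functors, natural transformations\<close>

record ('o, 'm) cat =
  Obj :: "'o set"
  Arr :: "'m set"
  Dom :: "'m \<Rightarrow> 'o"
  Cod :: "'m \<Rightarrow> 'o"
  Ident :: "'o \<Rightarrow> 'm"
  Comp :: "'m \<Rightarrow> 'm \<Rightarrow> 'm"  (infixl \<open>\<odot>\<index>\<close> 70)

definition Hom :: "('o, 'm) cat \<Rightarrow> 'o \<Rightarrow> 'o \<Rightarrow> 'm set" where
  "Hom C x y = {f \<in> Arr C. Dom C f = x \<and> Cod C f = y}"

locale category =
  fixes C :: "('o, 'm) cat" (structure)
  assumes Dom_in: "f \<in> Arr C \<Longrightarrow> Dom C f \<in> Obj C"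
    and Cod_in: "f \<in> Arr C \<Longrightarrow> Cod C f \<in> Obj C"
    and Ident_in: "x \<in> Obj C \<Longrightarrow> Ident C x \<in> Hom C x x"
    and Comp_in: "\<lbrakk>f \<in> Hom C x y; g \<in> Hom C y z\<rbrakk> \<Longrightarrow> g \<odot> f \<in> Hom C x z"
    and Comp_Ident: "f \<in> Hom C x y \<Longrightarrow> f \<odot> Ident C x = f"
    and Ident_Comp: "f \<in> Hom C x y \<Longrightarrow> Ident C y \<odot> f = f"
    and Comp_assoc: "\<lbrakk>f \<in> Hom C x y; g \<in> Hom C y z; h \<in> Hom C z w\<rbrakk>
                       \<Longrightarrow> h \<odot> (g \<odot> f) = (h \<odot> g) \<odot> f"

definition opposite :: "('o, 'm) cat \<Rightarrow> ('o, 'm) cat" where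
  "opposite C = \<lparr>Obj = Obj C, Arr = Arr C, Dom = Cod C, Cod = Dom C, Ident = Ident C,
                 Comp = (\<lambda>g f. Comp C f g)\<rparr>"

definition full_subcategory :: "('o, 'm) cat \<Rightarrow> ('o \<Rightarrow> bool) \<Rightarrow> ('o, 'm) cat" where
  "full_subcategory C S =
     C\<lparr>Obj := {x \<in> Obj C. S x}, Arr := {f \<in> Arr C. S (Dom C f) \<and> S (Cod C f)}\<rparr>"

definition is_iso :: "('o, 'm) cat \<Rightarrow> 'm \<Rightarrow> bool" where
  "is_iso C f \<longleftrightarrow> f \<in> Arr C \<and>
     (\<exists>g \<in> Hom C (Cod C f) (Dom C f).
        Comp C g f = Ident C (Dom C f) \<and> Comp C f g = Ident C (Cod C f))"

record ('i, 'j, 'o, 'm) funct =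
  OMap :: "'i \<Rightarrow> 'o"
  AMap :: "'j \<Rightarrow> 'm"

text \<open>
  The two maps of a functor, and the components of a natural transformation, are required to be
  \<^const>\<open>extensional\<close> (equal to \<^const>\<open>undefined\<close> off their domain), so that equality in HOL is
  equality of functors and of natural transformations.
\<close>

locale is_functor = C: category C + D: category D
  for C :: "('i, 'j) cat" and D :: "('o, 'm) cat" and F :: "('i, 'j, 'o, 'm) funct" +
  assumes OMap_ext: "OMap F \<in> extensional (Obj C)"
    and AMap_ext: "AMap F \<in> extensional (Arr C)"
    and OMap_in: "x \<in> Obj C \<Longrightarrow> OMap F x \<in> Obj D"
    and AMap_in: "f \<in> Hom C x y \<Longrightarrow> AMap F f \<in> Hom D (OMap F x) (OMap F y)"
    and AMap_Ident: "x \<in> Obj C \<Longrightarrow> AMap F (Ident C x) = Ident D (OMap F x)"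
    and AMap_Comp: "\<lbrakk>f \<in> Hom C x y; g \<in> Hom C y z\<rbrakk>
                      \<Longrightarrow> AMap F (Comp C g f) = Comp D (AMap F g) (AMap F f)"

definition id_functor :: "('o, 'm) cat \<Rightarrow> ('o, 'm, 'o, 'm) funct" where
  "id_functor C = \<lparr>OMap = (\<lambda>x\<in>Obj C. x), AMap = (\<lambda>f\<in>Arr C. f)\<rparr>"

text \<open>\<open>comp_functor C G F\<close> is \<open>G \<circ> F\<close>, where \<open>C\<close> is the source of \<open>F\<close>.\<close>

definition comp_functor ::
  "('i, 'j) cat \<Rightarrow> ('o, 'm, 'x, 'y) funct \<Rightarrow> ('i, 'j, 'o, 'm) funct \<Rightarrow> ('i, 'j, 'x, 'y) funct"
where
  "comp_functor C G F =
     \<lparr>OMap = (\<lambda>x\<in>Obj C. OMap G (OMap F x)), AMap = (\<lambda>f\<in>Arr C. AMap G (AMap F f))\<rparr>"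

locale natural_transformation = F: is_functor C D F + G: is_functor C D G
  for C :: "('i, 'j) cat" and D :: "('o, 'm) cat"
    and F G :: "('i, 'j, 'o, 'm) funct" and \<eta> :: "'i \<Rightarrow> 'm" +
  assumes component_ext: "\<eta> \<in> extensional (Obj C)"
    and component_in: "x \<in> Obj C \<Longrightarrow> \<eta> x \<in> Hom D (OMap F x) (OMap G x)"
    and naturality: "f \<in> Hom C x y
                       \<Longrightarrow> Comp D (\<eta> y) (AMap F f) = Comp D (AMap G f) (\<eta> x)"

definition naturally_isomorphic ::
  "('i, 'j) cat \<Rightarrow> ('o, 'm) cat \<Rightarrow> ('i, 'j, 'o, 'm) funct \<Rightarrow> ('i, 'j, 'o, 'm) funct \<Rightarrow> bool"
where
  "naturally_isomorphic C D F G \<longleftrightarrow>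
     (\<exists>\<eta>. natural_transformation C D F G \<eta> \<and> (\<forall>x \<in> Obj C. is_iso D (\<eta> x)))"

definition equivalent_categories :: "('i, 'j) cat \<Rightarrow> ('o, 'm) cat \<Rightarrow> bool" where
  "equivalent_categories C D \<longleftrightarrow> category C \<and> category D \<and>
     (\<exists>F G. is_functor C D F \<and> is_functor D C G \<and>
        naturally_isomorphic C C (id_functor C) (comp_functor C G F) \<and>
        naturally_isomorphic D D (comp_functor D F G) (id_functor D))"

text \<open>
  An arrow of \<open>[C, D]\<close> is a triple \<open>(F, \<eta>, G)\<close> with \<open>\<eta>\<close> a natural transformation from \<open>F\<close> to \<open>G\<close>.
\<close>

definition functor_category ::
  "('i, 'j) cat \<Rightarrow> ('o, 'm) cat \<Rightarrow>
     (('i, 'j, 'o, 'm) funct,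
      ('i, 'j, 'o, 'm) funct \<times> ('i \<Rightarrow> 'm) \<times> ('i, 'j, 'o, 'm) funct) cat"
where
  "functor_category C D =
     \<lparr>Obj = {F. is_functor C D F},
      Arr = {(F, \<eta>, G). natural_transformation C D F G \<eta>},
      Dom = (\<lambda>(F, \<eta>, G). F),
      Cod = (\<lambda>(F, \<eta>, G). G),
      Ident = (\<lambda>F. (F, (\<lambda>x\<in>Obj C. Ident D (OMap F x)), F)),
      Comp = (\<lambda>(_, \<theta>, H) (F, \<eta>, _). (F, (\<lambda>x\<in>Obj C. Comp D (\<theta> x) (\<eta> x)), H))\<rparr>"

section \<open>Limits\<close>

definition is_cone ::
  "('i, 'j) cat \<Rightarrow> ('o, 'm) cat \<Rightarrow> ('i, 'j, 'o, 'm) funct \<Rightarrow> 'o \<Rightarrow> ('i \<Rightarrow> 'm) \<Rightarrow> bool"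
where
  "is_cone J A D L \<phi> \<longleftrightarrow> L \<in> Obj A \<and>
     (\<forall>i \<in> Obj J. \<phi> i \<in> Hom A L (OMap D i)) \<and>
     (\<forall>u \<in> Arr J. Comp A (AMap D u) (\<phi> (Dom J u)) = \<phi> (Cod J u))"

definition is_limit ::
  "('i, 'j) cat \<Rightarrow> ('o, 'm) cat \<Rightarrow> ('i, 'j, 'o, 'm) funct \<Rightarrow> 'o \<Rightarrow> ('i \<Rightarrow> 'm) \<Rightarrow> bool"
where
  "is_limit J A D L \<phi> \<longleftrightarrow> is_cone J A D L \<phi> \<and>
     (\<forall>Z \<psi>. is_cone J A D Z \<psi> \<longrightarrow>
        (\<exists>!h. h \<in> Hom A Z L \<and> (\<forall>i \<in> Obj J. Comp A (\<phi> i) h = \<psi> i)))"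

text \<open>
  Completeness means having all small limits. Since HOL cannot quantify over types inside a
  formula, the size bound is a type parameter \<open>'u\<close>: the shapes considered are the categories whose
  objects and arrows are elements of \<open>'u\<close>, that is, up to isomorphism, all categories with at most
  \<open>|'u|\<close> objects and at most \<open>|'u|\<close> arrows. A category that is complete in the usual sense is
  \<open>complete_category\<close> for every small \<open>'u\<close>. For a statement about sheaves on a set \<open>P\<close> the bound
  has to be large enough for \<open>P\<close> to count as small: \<open>'u\<close> is infinite and \<open>Pow P\<close> embeds into it,
  so that products indexed by open covers exist. The type \<open>nat + 'p set\<close> always qualifies for
  \<open>P :: 'p set\<close>.
\<close>

definition complete_category :: "'u itself \<Rightarrow> ('o, 'm) cat \<Rightarrow> bool" where
  "complete_category (_ :: 'u itself) A \<longleftrightarrow> category A \<and>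
     (\<forall>(J :: ('u, 'u) cat) D. is_functor J A D \<longrightarrow> (\<exists>L \<phi>. is_limit J A D L \<phi>))"

definition is_product ::
  "('o, 'm) cat \<Rightarrow> 'i set \<Rightarrow> ('i \<Rightarrow> 'o) \<Rightarrow> 'o \<Rightarrow> ('i \<Rightarrow> 'm) \<Rightarrow> bool"
where
  "is_product A I X p \<pi> \<longleftrightarrow> p \<in> Obj A \<and> (\<forall>i \<in> I. \<pi> i \<in> Hom A p (X i)) \<and>
     (\<forall>Z \<in> Obj A. \<forall>\<psi>. (\<forall>i \<in> I. \<psi> i \<in> Hom A Z (X i)) \<longrightarrow>
        (\<exists>!h. h \<in> Hom A Z p \<and> (\<forall>i \<in> I. Comp A (\<pi> i) h = \<psi> i)))"

definition is_equalizer :: "('o, 'm) cat \<Rightarrow> 'm \<Rightarrow> 'm \<Rightarrow> 'm \<Rightarrow> bool" where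
  "is_equalizer A s t e \<longleftrightarrow>
     s \<in> Arr A \<and> t \<in> Hom A (Dom A s) (Cod A s) \<and>
     e \<in> Arr A \<and> Cod A e = Dom A s \<and> Comp A s e = Comp A t e \<and>
     (\<forall>k \<in> Arr A. Cod A k = Dom A s \<and> Comp A s k = Comp A t k \<longrightarrow>
        (\<exists>!h. h \<in> Hom A (Dom A k) (Dom A e) \<and> Comp A e h = k))"

section \<open>Preorders and cellular sheaves\<close>

text \<open>\<open>(x, y) \<in> r\<close> encodes \<open>x \<lesssim> y\<close>, and the pair itself serves as the unique arrow from \<open>x\<close> to \<open>y\<close>.\<close>

definition preorder_category :: "'p set \<Rightarrow> 'p rel \<Rightarrow> ('p, 'p \<times> 'p) cat" where
  "preorder_category P r =
     \<lparr>Obj = P, Arr = r, Dom = fst, Cod = snd, Ident = (\<lambda>x. (x, x)),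
      Comp = (\<lambda>g f. (fst f, snd g))\<rparr>"

definition is_cellular_sheaf ::
  "'p rel \<Rightarrow> ('o, 'm) cat \<Rightarrow> ('p, 'p \<times> 'p, 'o, 'm) funct \<Rightarrow> bool"
where
  "is_cellular_sheaf r A F \<longleftrightarrow>
     (\<forall>x y. (x, y) \<in> r \<and> (y, x) \<in> r \<longrightarrow>
        OMap F x = OMap F y \<and>
        AMap F (x, y) = Ident A (OMap F x) \<and> AMap F (y, x) = Ident A (OMap F x))"

definition Cell where
  "Cell P r A =
     full_subcategory (functor_category (preorder_category P r) A) (is_cellular_sheaf r A)"

definition up_set :: "'p set \<Rightarrow> 'p rel \<Rightarrow> 'p \<Rightarrow> 'p set" where
  "up_set P r p = {q \<in> P. (p, q) \<in> r}"

text \<open>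
  \<open>topology\<close> is only meaningful on predicates satisfying \<open>istopology\<close>; for a preorder this holds by
  \<open>istopology_alexandrov\<close>.
\<close>

definition alexandrov :: "'p set \<Rightarrow> 'p rel \<Rightarrow> 'p topology" where
  "alexandrov P r = topology (arbitrary union_of (\<lambda>S. \<exists>p\<in>P. S = up_set P r p))"

lemma alexandrov_base:
  assumes "preorder_on P r"
  shows "(arbitrary union_of (\<lambda>S. \<exists>p\<in>P. S = up_set P r p)) U \<longleftrightarrow>
           U \<subseteq> P \<and> (\<forall>x y. x \<in> U \<and> (x, y) \<in> r \<longrightarrow> y \<in> U)"
proof -
  have rf: "\<And>x. x \<in> P \<Longrightarrow> (x, x) \<in> r" and tr: "trans r" and fl: "r \<subseteq> P \<times> P"
    using assms by (auto simp: preorder_on_def refl_on_def)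
  show ?thesis
    unfolding arbitrary_union_of_alt
  proof (intro iffI conjI allI impI ballI subsetI)
    fix x y assume h: "\<forall>x\<in>U. \<exists>S. (\<exists>p\<in>P. S = up_set P r p) \<and> x \<in> S \<and> S \<subseteq> U"
      and xy: "x \<in> U \<and> (x, y) \<in> r"
    then obtain p where "x \<in> up_set P r p" "up_set P r p \<subseteq> U" by blast
    then show "y \<in> U" using xy tr fl by (auto simp: up_set_def dest: transD)
  next
    fix x assume "\<forall>x\<in>U. \<exists>S. (\<exists>p\<in>P. S = up_set P r p) \<and> x \<in> S \<and> S \<subseteq> U" "x \<in> U"
    then show "x \<in> P" by (auto simp: up_set_def)
  next
    fix x assume h: "U \<subseteq> P \<and> (\<forall>x y. x \<in> U \<and> (x, y) \<in> r \<longrightarrow> y \<in> U)" "x \<in> U"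
    then show "\<exists>S. (\<exists>p\<in>P. S = up_set P r p) \<and> x \<in> S \<and> S \<subseteq> U"
      by (intro exI[of _ "up_set P r x"]) (auto simp: up_set_def rf)
  qed
qed

lemma istopology_alexandrov:
  assumes "preorder_on P r"
  shows "istopology (arbitrary union_of (\<lambda>S. \<exists>p\<in>P. S = up_set P r p))"
  unfolding istopology_base_alt alexandrov_base[OF assms] by blast

lemma openin_alexandrov:
  assumes "preorder_on P r"
  shows "openin (alexandrov P r) U \<longleftrightarrow> U \<subseteq> P \<and> (\<forall>x y. x \<in> U \<and> (x, y) \<in> r \<longrightarrow> y \<in> U)"
  by (simp add: alexandrov_def topology_inverse' istopology_alexandrov alexandrov_base assms)

section \<open>Sheaves on a topological space\<close>

definition opens_category :: "'p topology \<Rightarrow> ('p set, 'p set \<times> 'p set) cat" where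
  "opens_category X =
     preorder_category {U. openin X U} {(U, V). openin X U \<and> openin X V \<and> U \<subseteq> V}"

text \<open>
  For every open cover \<open>\<U>\<close> of an open set \<open>U\<close> (including the empty cover of the empty set), the diagram
  \<open>F(U) \<rightarrow> \<Prod>V. F(V) \<rightrightarrows> \<Prod>(V, W). F(V \<inter> W)\<close> is an equalizer. The restriction from \<open>F(U)\<close> to
  \<open>F(V)\<close> is \<open>AMap F (V, U)\<close>, an arrow of \<open>opens_category X\<close> being the pair of an open subset and a
  larger one.
\<close>

definition is_sheaf ::
  "'p topology \<Rightarrow> ('o, 'm) cat \<Rightarrow> ('p set, 'p set \<times> 'p set, 'o, 'm) funct \<Rightarrow> bool"
where
  "is_sheaf X A F \<longleftrightarrow>
     (\<forall>U \<U>. openin X U \<and> (\<forall>V\<in>\<U>. openin X V) \<and> \<Union>\<U> = U \<longrightarrow>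
        (\<exists>p \<pi> q \<rho> e s t.
           is_product A \<U> (OMap F) p \<pi> \<and>
           is_product A (\<U> \<times> \<U>) (\<lambda>(V, W). OMap F (V \<inter> W)) q \<rho> \<and>
           e \<in> Hom A (OMap F U) p \<and> s \<in> Hom A p q \<and> t \<in> Hom A p q \<and>
           (\<forall>V\<in>\<U>. Comp A (\<pi> V) e = AMap F (V, U)) \<and>
           (\<forall>V\<in>\<U>. \<forall>W\<in>\<U>.
              Comp A (\<rho> (V, W)) s = Comp A (AMap F (V \<inter> W, V)) (\<pi> V) \<and>
              Comp A (\<rho> (V, W)) t = Comp A (AMap F (V \<inter> W, W)) (\<pi> W)) \<and>
           is_equalizer A s t e))"

definition Sh where
  "Sh X A = full_subcategory (functor_category (opposite (opens_category X)) A) (is_sheaf X A)"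

end

theory Submission
  imports Defs
begin

text \<open>
  In the Alexandrov topology every point \<open>p\<close> has a least open neighbourhood \<open>up p\<close>, so the stalk of a
  presheaf \<open>F\<close> at \<open>p\<close> is \<open>F(up p)\<close>, and the restrictions between these objects make the stalks a functor
  on the preorder. Since \<open>up p\<close> depends only on the equivalence class of \<open>p\<close>, this functor is
  cellular. The equivalence is the functor that sends \<open>F\<close> to its stalks.

  The main point is that \<open>F\<close> is a sheaf if and only if, for every open \<open>U\<close>, the object \<open>F(U)\<close> is the
  limit of the stalks at the points of \<open>U\<close> (\<open>is_sheaf_iff_stalkwise\<close>). The sheaf condition is
  equivalent to unique gluing of matching families of generalized sections, that is, of arrows from a
  varying object \<open>Z\<close>. A cone over the stalks is then a matching family on the cover of \<open>U\<close> by the sets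
  \<open>up p\<close>. Conversely, a matching family on any cover restricts to a cone over the stalks.

  The limit description makes natural transformations into a sheaf determined by, and constructible
  from, their components at the stalks: the stalk functor is fully faithful. It is also surjective on
  objects, not only up to isomorphism. Given a cellular sheaf \<open>F\<close>, put \<open>G(U) = lim F(p)\<close> over the points
  \<open>p\<close> of \<open>U\<close>. The diagram on \<open>up p\<close> has the initial object \<open>p\<close>, so \<open>F(p)\<close> is one of its limits; because
  \<open>F\<close> is cellular, this choice does not depend on which \<open>p\<close> generates the open set, and with it the
  stalks of \<open>G\<close> are exactly \<open>F\<close>. A fully faithful functor that is surjective on objects is an
  equivalence.

  Completeness speaks about shapes contained in a type \<open>'u\<close> only. All limits used here are
  indexed by preorders on subsets of \<open>P\<close> or by sets of open sets and pairs of them. Their objects and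
  arrows embed into \<open>'u\<close>, because \<open>'u \<times> 'u\<close> has the cardinality of the infinite type \<open>'u\<close>.
\<close>

section \<open>Functor categories and full subcategories\<close>

lemma Hom_full_subcategory:
  "f \<in> Hom (full_subcategory C S) x y \<longleftrightarrow> f \<in> Hom C x y \<and> S x \<and> S y"
  by (auto simp: Hom_def full_subcategory_def)

lemma category_full_subcategory:
  assumes "category C"
  shows "category (full_subcategory C S)"
proof -
  interpret category C by fact
  show ?thesis
  proof
    fix f assume "f \<in> Arr (full_subcategory C S)"
    then show "Dom (full_subcategory C S) f \<in> Obj (full_subcategory C S)"
      and "Cod (full_subcategory C S) f \<in> Obj (full_subcategory C S)"
      by (auto simp: full_subcategory_def Dom_in Cod_in)
  next
    fix x assume "x \<in> Obj (full_subcategory C S)"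
    then show "Ident (full_subcategory C S) x \<in> Hom (full_subcategory C S) x x"
      using Ident_in[of x] by (simp add: Hom_full_subcategory) (simp add: full_subcategory_def)
  qed (unfold Hom_full_subcategory,
       auto simp: full_subcategory_def Comp_in Comp_Ident Ident_Comp Comp_assoc)
qed

lemma Hom_functor_category:
  "t \<in> Hom (functor_category C D) F G \<longleftrightarrow>
     (\<exists>\<eta>. t = (F, \<eta>, G) \<and> natural_transformation C D F G \<eta>)"
  by (auto simp: Hom_def functor_category_def)

lemma natural_transformation_ident:
  assumes "is_functor C D F"
  shows "natural_transformation C D F F (\<lambda>x\<in>Obj C. Ident D (OMap F x))"
proof -
  interpret is_functor C D F by fact
  show ?thesis
  proof
    fix f x y assume f: "f \<in> Hom C x y"
    then have "x \<in> Obj C" "y \<in> Obj C"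
      by (auto simp: Hom_def C.Dom_in C.Cod_in)
    then show "Comp D ((\<lambda>x\<in>Obj C. Ident D (OMap F x)) y) (AMap F f) =
               Comp D (AMap F f) ((\<lambda>x\<in>Obj C. Ident D (OMap F x)) x)"
      using AMap_in[OF f] by (simp add: D.Comp_Ident D.Ident_Comp)
  qed (auto simp: D.Ident_in OMap_in)
qed

lemma natural_transformation_comp:
  assumes "natural_transformation C D F G \<eta>" and "natural_transformation C D G H \<theta>"
  shows "natural_transformation C D F H (\<lambda>x\<in>Obj C. Comp D (\<theta> x) (\<eta> x))"
proof -
  interpret e: natural_transformation C D F G \<eta> by fact
  interpret t: natural_transformation C D G H \<theta> by fact
  show ?thesis
  proof
    fix f x y assume f: "f \<in> Hom C x y"
    then have x: "x \<in> Obj C" and y: "y \<in> Obj C"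
      by (auto simp: Hom_def e.F.C.Dom_in e.F.C.Cod_in)
    note in_Hom = e.component_in[OF x] e.component_in[OF y] t.component_in[OF x]
      t.component_in[OF y] e.F.AMap_in[OF f] t.G.AMap_in[OF f] e.G.AMap_in[OF f]
    have "Comp D (Comp D (\<theta> y) (\<eta> y)) (AMap F f) = Comp D (Comp D (\<theta> y) (AMap G f)) (\<eta> x)"
      using in_Hom e.naturality[OF f] by (simp flip: e.F.D.Comp_assoc)
    also have "\<dots> = Comp D (AMap H f) (Comp D (\<theta> x) (\<eta> x))"
      using in_Hom t.naturality[OF f] by (simp add: e.F.D.Comp_assoc)
    finally show "Comp D ((\<lambda>x\<in>Obj C. Comp D (\<theta> x) (\<eta> x)) y) (AMap F f) =
               Comp D (AMap H f) ((\<lambda>x\<in>Obj C. Comp D (\<theta> x) (\<eta> x)) x)"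
      using x y by simp
  qed (auto intro: e.F.D.Comp_in e.component_in t.component_in)
qed

lemma natural_transformation_eqI:
  assumes "natural_transformation C D F G \<eta>" and "natural_transformation C D F G \<theta>"
    and "\<And>x. x \<in> Obj C \<Longrightarrow> \<eta> x = \<theta> x"
  shows "\<eta> = \<theta>"
  using assms by (metis extensionalityI natural_transformation.component_ext)

lemma category_functor_category: "category (functor_category C D)"
proof
  fix f assume "f \<in> Arr (functor_category C D)"
  then show "Dom (functor_category C D) f \<in> Obj (functor_category C D)"
    and "Cod (functor_category C D) f \<in> Obj (functor_category C D)"
    by (auto simp: functor_category_def natural_transformation_def)
next
  fix F assume "F \<in> Obj (functor_category C D)"
  then show "Ident (functor_category C D) F \<in> Hom (functor_category C D) F F"
    unfolding Hom_functor_category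
    by (simp add: functor_category_def natural_transformation_ident)
next
  fix f g F G H
  assume "f \<in> Hom (functor_category C D) F G" "g \<in> Hom (functor_category C D) G H"
  then show "Comp (functor_category C D) g f \<in> Hom (functor_category C D) F H"
    unfolding Hom_functor_category
    by (auto simp: functor_category_def natural_transformation_comp)
next
  fix f F G assume "f \<in> Hom (functor_category C D) F G"
  then obtain \<eta> where f: "f = (F, \<eta>, G)" and \<eta>: "natural_transformation C D F G \<eta>"
    by (auto simp: Hom_functor_category)
  interpret natural_transformation C D F G \<eta> by fact
  have "(\<lambda>x\<in>Obj C. Comp D (\<eta> x) ((\<lambda>x\<in>Obj C. Ident D (OMap F x)) x)) = \<eta>"
    by (rule extensionalityI[OF restrict_extensional component_ext])
       (simp add: F.D.Comp_Ident[OF component_in])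
  then show "Comp (functor_category C D) f (Ident (functor_category C D) F) = f"
    by (simp add: f functor_category_def)
  have "(\<lambda>x\<in>Obj C. Comp D ((\<lambda>x\<in>Obj C. Ident D (OMap G x)) x) (\<eta> x)) = \<eta>"
    by (rule extensionalityI[OF restrict_extensional component_ext])
       (simp add: F.D.Ident_Comp[OF component_in])
  then show "Comp (functor_category C D) (Ident (functor_category C D) G) f = f"
    by (simp add: f functor_category_def)
next
  fix f g h F G H K
  assume "f \<in> Hom (functor_category C D) F G" "g \<in> Hom (functor_category C D) G H"
    "h \<in> Hom (functor_category C D) H K"
  then obtain \<eta> \<theta> \<kappa> where fgh: "f = (F, \<eta>, G)" "g = (G, \<theta>, H)" "h = (H, \<kappa>, K)"
    and nt: "natural_transformation C D F G \<eta>" "natural_transformation C D G H \<theta>"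
      "natural_transformation C D H K \<kappa>"
    by (auto simp: Hom_functor_category)
  interpret category D
    using nt(1) by (simp add: natural_transformation_def is_functor_def)
  note in_Hom = nt[THEN natural_transformation.component_in]
  show "Comp (functor_category C D) h (Comp (functor_category C D) g f) =
        Comp (functor_category C D) (Comp (functor_category C D) h g) f"
    by (auto simp: fgh functor_category_def Comp_assoc[OF in_Hom] intro!: restrict_ext)
qed

section \<open>Fully faithful functors that are surjective on objects\<close>

text \<open>
  Choosing an object over every object of \<open>C\<close> and the unique arrow over every arrow gives a functor
  \<open>\<Psi>\<close> that is a strict section of \<open>\<Phi>\<close>. The isomorphism from \<open>\<Psi> (\<Phi> x)\<close> to \<open>x\<close> is the arrow over the
  identity of \<open>\<Phi> x\<close>; it is natural because \<open>\<Phi>\<close> is faithful.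
\<close>

lemma equivalent_categories_if_fully_faithful_surjective:
  assumes is_functor: "is_functor D C \<Phi>"
    and surj: "Obj C \<subseteq> OMap \<Phi> ` Obj D"
    and bij: "\<And>x y. \<lbrakk>x \<in> Obj D; y \<in> Obj D\<rbrakk>
                \<Longrightarrow> bij_betw (AMap \<Phi>) (Hom D x y) (Hom C (OMap \<Phi> x) (OMap \<Phi> y))"
  shows "equivalent_categories C D"
proof -
  interpret D: category D using is_functor by (simp add: is_functor_def)
  interpret C: category C using is_functor by (simp add: is_functor_def)
  interpret is_functor D C \<Phi> by fact
  define s where "s = inv_into (Obj D) (OMap \<Phi>)"
  have s_in: "s c \<in> Obj D" and \<Phi>_s: "OMap \<Phi> (s c) = c" if "c \<in> Obj C" for c
    using that surj by (auto simp: s_def inv_into_into f_inv_into_f)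
  define lift where "lift x y = inv_into (Hom D x y) (AMap \<Phi>)" for x y
  have lift_in: "lift x y f \<in> Hom D x y" and \<Phi>_lift: "AMap \<Phi> (lift x y f) = f"
    if "x \<in> Obj D" "y \<in> Obj D" "f \<in> Hom C (OMap \<Phi> x) (OMap \<Phi> y)" for x y f
    using bij[OF that(1,2)] that(3)
    by (auto simp: lift_def bij_betw_def inv_into_into f_inv_into_f)
  have faithful: "f = g" if "f \<in> Hom D x y" "g \<in> Hom D x y" "AMap \<Phi> f = AMap \<Phi> g" for x y f g
  proof -
    have "x \<in> Obj D" "y \<in> Obj D" using that(1) by (auto simp: Hom_def D.Dom_in D.Cod_in)
    then show ?thesis using bij that by (auto simp: bij_betw_def dest: inj_onD)
  qed
  define \<Psi> where "\<Psi> = \<lparr>OMap = restrict s (Obj C),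
     AMap = (\<lambda>f\<in>Arr C. lift (s (Dom C f)) (s (Cod C f)) f)\<rparr>"
  have \<Psi>_obj: "OMap \<Psi> c = s c" if "c \<in> Obj C" for c
    using that by (simp add: \<Psi>_def)
  have \<Psi>_arr: "AMap \<Psi> f = lift (s x) (s y) f" "AMap \<Psi> f \<in> Hom D (s x) (s y)"
    "AMap \<Phi> (AMap \<Psi> f) = f" "x \<in> Obj C" "y \<in> Obj C"
    if "f \<in> Hom C x y" for f x y
  proof -
    show x: "x \<in> Obj C" and y: "y \<in> Obj C"
      using that by (auto simp: Hom_def C.Dom_in C.Cod_in)
    show *: "AMap \<Psi> f = lift (s x) (s y) f" using that by (auto simp: \<Psi>_def Hom_def)
    show "AMap \<Psi> f \<in> Hom D (s x) (s y)" "AMap \<Phi> (AMap \<Psi> f) = f"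
      using lift_in[of "s x" "s y" f] \<Phi>_lift[of "s x" "s y" f] x y s_in \<Phi>_s that
      unfolding * by auto
  qed
  have \<Psi>: "is_functor C D \<Psi>"
  proof
    fix x assume x: "x \<in> Obj C"
    note i = C.Ident_in[OF x]
    show "OMap \<Psi> x \<in> Obj D" by (simp add: \<Psi>_obj s_in x)
    show "AMap \<Psi> (Ident C x) = Ident D (OMap \<Psi> x)"
      unfolding \<Psi>_obj[OF x]
      by (rule faithful[OF \<Psi>_arr(2)[OF i] D.Ident_in[OF s_in[OF x]]])
         (simp add: \<Psi>_arr(3)[OF i] AMap_Ident s_in \<Phi>_s x)
  next
    fix f x y assume "f \<in> Hom C x y"
    then show "AMap \<Psi> f \<in> Hom D (OMap \<Psi> x) (OMap \<Psi> y)"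
      using \<Psi>_arr[of f x y] by (simp add: \<Psi>_obj)
  next
    fix f g x y z assume f: "f \<in> Hom C x y" and g: "g \<in> Hom C y z"
    note gf = C.Comp_in[OF f g]
    show "AMap \<Psi> (Comp C g f) = Comp D (AMap \<Psi> g) (AMap \<Psi> f)"
      by (rule faithful[OF \<Psi>_arr(2)[OF gf] D.Comp_in[OF \<Psi>_arr(2)[OF f] \<Psi>_arr(2)[OF g]]])
         (simp add: AMap_Comp[OF \<Psi>_arr(2)[OF f] \<Psi>_arr(2)[OF g]]
            \<Psi>_arr(3)[OF f] \<Psi>_arr(3)[OF g] \<Psi>_arr(3)[OF gf])
  qed (simp_all add: \<Psi>_def)
  interpret \<Psi>: is_functor C D \<Psi> by fact
  have id: "is_functor E E (id_functor E)" if "category E" for E :: "('x, 'y) cat"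
  proof -
    interpret category E by fact
    show ?thesis
      by standard (auto simp: id_functor_def Hom_def Comp_in Dom_in Cod_in
          Ident_in[unfolded Hom_def, simplified] Comp_in[unfolded Hom_def, simplified])
  qed
  have \<Phi>\<Psi>: "comp_functor C \<Phi> \<Psi> = id_functor C"
  proof -
    have "AMap \<Phi> (AMap \<Psi> f) = f" if "f \<in> Arr C" for f
      using \<Psi>_arr(3)[of f "Dom C f" "Cod C f"] that by (simp add: Hom_def)
    then show ?thesis
      unfolding comp_functor_def id_functor_def
      by (auto simp: \<Psi>_obj \<Phi>_s intro!: restrict_ext)
  qed
  have "naturally_isomorphic C C (id_functor C) (comp_functor C \<Phi> \<Psi>)"
    unfolding naturally_isomorphic_def \<Phi>\<Psi>
  proof (intro exI conjI ballI)
    show "natural_transformation C C (id_functor C) (id_functor C)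
            (\<lambda>x\<in>Obj C. Ident C (OMap (id_functor C) x))"
      by (rule natural_transformation_ident[OF id]) (rule C.category_axioms)
    fix x assume x: "x \<in> Obj C"
    have "Ident C x \<in> Hom C x x" by (rule C.Ident_in[OF x])
    then show "is_iso C ((\<lambda>x\<in>Obj C. Ident C (OMap (id_functor C) x)) x)"
      using x C.Ident_Comp[OF C.Ident_in[OF x]]
      by (auto simp: is_iso_def id_functor_def Hom_def)
  qed
  moreover have "naturally_isomorphic D D (comp_functor D \<Psi> \<Phi>) (id_functor D)"
    unfolding naturally_isomorphic_def
  proof (intro exI conjI ballI)
    let ?e = "\<lambda>x\<in>Obj D. lift (s (OMap \<Phi> x)) x (Ident C (OMap \<Phi> x))"
    have \<Psi>\<Phi>_arr: "AMap \<Psi> (AMap \<Phi> f) \<in> Hom D (s (OMap \<Phi> x)) (s (OMap \<Phi> y))"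
        "AMap \<Phi> (AMap \<Psi> (AMap \<Phi> f)) = AMap \<Phi> f"
      if "f \<in> Hom D x y" for f x y
      using \<Psi>_arr[OF AMap_in[OF that]] by auto
    have e: "lift (s (OMap \<Phi> x)) x (Ident C (OMap \<Phi> x)) \<in> Hom D (s (OMap \<Phi> x)) x"
      "AMap \<Phi> (lift (s (OMap \<Phi> x)) x (Ident C (OMap \<Phi> x))) = Ident C (OMap \<Phi> x)"
      if "x \<in> Obj D" for x
      using lift_in[of "s (OMap \<Phi> x)" x] \<Phi>_lift[of "s (OMap \<Phi> x)" x] that
      by (simp_all add: s_in \<Phi>_s OMap_in C.Ident_in)
    have "is_functor D D (comp_functor D \<Psi> \<Phi>)"
    proof
      fix f x y assume f: "f \<in> Hom D x y"
      then have "x \<in> Obj D" "y \<in> Obj D" "f \<in> Arr D"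
        by (auto simp: Hom_def D.Dom_in D.Cod_in)
      then show "AMap (comp_functor D \<Psi> \<Phi>) f
          \<in> Hom D (OMap (comp_functor D \<Psi> \<Phi>) x) (OMap (comp_functor D \<Psi> \<Phi>) y)"
        using \<Psi>.AMap_in[OF AMap_in[OF f]] by (simp add: comp_functor_def)
    next
      fix x assume x: "x \<in> Obj D"
      then have "Ident D x \<in> Arr D" using D.Ident_in by (auto simp: Hom_def)
      then show "AMap (comp_functor D \<Psi> \<Phi>) (Ident D x) =
                 Ident D (OMap (comp_functor D \<Psi> \<Phi>) x)"
        using x by (simp add: comp_functor_def AMap_Ident \<Psi>.AMap_Ident OMap_in)
    next
      fix f g x y z assume f: "f \<in> Hom D x y" and g: "g \<in> Hom D y z"
      then have "f \<in> Arr D" "g \<in> Arr D" "Comp D g f \<in> Arr D"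
        using D.Comp_in[OF f g] by (auto simp: Hom_def)
      then show "AMap (comp_functor D \<Psi> \<Phi>) (Comp D g f) =
          Comp D (AMap (comp_functor D \<Psi> \<Phi>) g) (AMap (comp_functor D \<Psi> \<Phi>) f)"
        by (simp add: comp_functor_def AMap_Comp[OF f g]
              \<Psi>.AMap_Comp[OF AMap_in[OF f] AMap_in[OF g]])
    qed (auto simp: comp_functor_def OMap_in \<Psi>.OMap_in)
    moreover have "natural_transformation_axioms D D (comp_functor D \<Psi> \<Phi>) (id_functor D) ?e"
    proof
      fix x assume x: "x \<in> Obj D"
      then show "?e x \<in> Hom D (OMap (comp_functor D \<Psi> \<Phi>) x) (OMap (id_functor D) x)"
        using e(1) by (simp add: comp_functor_def id_functor_def \<Psi>_obj OMap_in)
    next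
      fix f x y assume f: "f \<in> Hom D x y"
      then have xy: "x \<in> Obj D" "y \<in> Obj D" "f \<in> Arr D"
        by (auto simp: Hom_def D.Dom_in D.Cod_in)
      have "Comp D (?e y) (AMap \<Psi> (AMap \<Phi> f)) = Comp D f (?e x)"
      proof (rule faithful)
        show "Comp D (?e y) (AMap \<Psi> (AMap \<Phi> f)) \<in> Hom D (s (OMap \<Phi> x)) y"
          using D.Comp_in[OF \<Psi>\<Phi>_arr(1)[OF f] e(1)] xy by simp
        show "Comp D f (?e x) \<in> Hom D (s (OMap \<Phi> x)) y"
          using D.Comp_in[OF e(1) f] xy by simp
        show "AMap \<Phi> (Comp D (?e y) (AMap \<Psi> (AMap \<Phi> f))) = AMap \<Phi> (Comp D f (?e x))"
          using xy AMap_Comp[OF \<Psi>\<Phi>_arr(1)[OF f] e(1)] AMap_Comp[OF e(1) f]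
            C.Ident_Comp[OF AMap_in[OF f]] C.Comp_Ident[OF AMap_in[OF f]]
          by (simp add: e(2) \<Psi>\<Phi>_arr(2)[OF f])
      qed
      then show "Comp D (?e y) (AMap (comp_functor D \<Psi> \<Phi>) f) =
                 Comp D (AMap (id_functor D) f) (?e x)"
        using xy by (simp add: comp_functor_def id_functor_def)
    qed simp
    ultimately show "natural_transformation D D (comp_functor D \<Psi> \<Phi>) (id_functor D) ?e"
      using id[OF D.category_axioms] by (simp add: natural_transformation_def)
    fix x assume x: "x \<in> Obj D"
    let ?i = "lift x (s (OMap \<Phi> x)) (Ident C (OMap \<Phi> x))"
    have x': "s (OMap \<Phi> x) \<in> Obj D" "OMap \<Phi> (s (OMap \<Phi> x)) = OMap \<Phi> x"
      using x by (simp_all add: s_in \<Phi>_s OMap_in)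
    have i: "?i \<in> Hom D x (s (OMap \<Phi> x))" "AMap \<Phi> ?i = Ident C (OMap \<Phi> x)"
      using lift_in[OF x x'(1)] \<Phi>_lift[OF x x'(1)] x
      by (simp_all add: x' C.Ident_in OMap_in)
    have "AMap \<Phi> (Comp D ?i (?e x)) = AMap \<Phi> (Ident D (s (OMap \<Phi> x)))"
      using AMap_Comp[OF e(1)[OF x] i(1)] x C.Ident_Comp[OF C.Ident_in] AMap_Ident[OF x'(1)]
      by (simp add: e(2) i(2) x'(2) OMap_in)
    then have 1: "Comp D ?i (?e x) = Ident D (s (OMap \<Phi> x))"
      using faithful[OF D.Comp_in[OF e(1)[OF x] i(1)] D.Ident_in[OF x'(1)]] x by simp
    have "AMap \<Phi> (Comp D (?e x) ?i) = AMap \<Phi> (Ident D x)"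
      using AMap_Comp[OF i(1) e(1)[OF x]] x C.Ident_Comp[OF C.Ident_in] AMap_Ident[OF x]
      by (simp add: e(2) i(2) OMap_in)
    then have 2: "Comp D (?e x) ?i = Ident D x"
      using faithful[OF D.Comp_in[OF i(1) e(1)[OF x]] D.Ident_in[OF x]] x by simp
    show "is_iso D (?e x)"
      using e(1)[OF x] i(1) 1 2 x unfolding is_iso_def Hom_def by auto
  qed
  ultimately show ?thesis
    unfolding equivalent_categories_def
    using \<Psi> is_functor C.category_axioms D.category_axioms by blast
qed

section \<open>Limits over small preorders\<close>

text \<open>
  A diagram whose shape merely embeds into the type \<open>'u\<close> is carried to one with shape in \<open>'u\<close> along
  injections of the objects and of the arrows; both diagrams have the same cones.
\<close>

lemma limit_exists_if_lepoll:
  fixes J :: "('i, 'j) cat" and A :: "('o, 'm) cat"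
  assumes complete: "complete_category TYPE('u) A"
    and Obj_le: "Obj J \<lesssim> (UNIV :: 'u set)" and Arr_le: "Arr J \<lesssim> (UNIV :: 'u set)"
    and D: "is_functor J A D"
  shows "\<exists>L \<phi>. is_limit J A D L \<phi>"
proof -
  interpret J: category J using D by (simp add: is_functor_def)
  interpret A: category A using D by (simp add: is_functor_def)
  interpret is_functor J A D by fact
  obtain a :: "'i \<Rightarrow> 'u" where a: "inj_on a (Obj J)"
    using Obj_le by (auto simp: lepoll_def)
  obtain b :: "'j \<Rightarrow> 'u" where b: "inj_on b (Arr J)"
    using Arr_le by (auto simp: lepoll_def)
  define a' where "a' = inv_into (Obj J) a"
  define b' where "b' = inv_into (Arr J) b"
  have a'_a [simp]: "a' (a x) = x" if "x \<in> Obj J" for x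
    using that a by (simp add: a'_def)
  have b'_b [simp]: "b' (b f) = f" if "f \<in> Arr J" for f
    using that b by (simp add: b'_def)
  define J' :: "('u, 'u) cat" where
    "J' = \<lparr>Obj = a ` Obj J, Arr = b ` Arr J,
           Dom = (\<lambda>u. a (Dom J (b' u))), Cod = (\<lambda>u. a (Cod J (b' u))),
           Ident = (\<lambda>i. b (Ident J (a' i))), Comp = (\<lambda>v u. b (Comp J (b' v) (b' u)))\<rparr>"
  define D' where
    "D' = \<lparr>OMap = (\<lambda>i\<in>a ` Obj J. OMap D (a' i)), AMap = (\<lambda>u\<in>b ` Arr J. AMap D (b' u))\<rparr>"
  have Hom_Arr: "f \<in> Arr J" "x \<in> Obj J" "y \<in> Obj J" if "f \<in> Hom J x y" for f x y
    using that by (auto simp: Hom_def J.Dom_in J.Cod_in)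
  have Hom_J'I: "b f \<in> Hom J' (a x) (a y)" if "f \<in> Hom J x y" for f x y
    using that by (auto simp: Hom_def J'_def)
  have Hom_J'E: "\<exists>x\<in>Obj J. \<exists>y\<in>Obj J. \<exists>f\<in>Hom J x y. i = a x \<and> k = a y \<and> u = b f"
    if "u \<in> Hom J' i k" for u i k
    using that b'_b J.Dom_in J.Cod_in by (fastforce simp: Hom_def J'_def)
  have a_eq: "a x = a y \<longleftrightarrow> x = y" if "x \<in> Obj J" "y \<in> Obj J" for x y
    using that a by (auto dest: inj_onD)
  have "category J'"
  proof
    fix i assume "i \<in> Obj J'"
    then obtain x where x: "x \<in> Obj J" "i = a x" by (auto simp: J'_def)
    then show "Ident J' i \<in> Hom J' i i"
      using Hom_J'I[OF J.Ident_in[OF x(1)]] by (simp add: J'_def)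
  next
    fix u v i j k assume "u \<in> Hom J' i j" "v \<in> Hom J' j k"
    then obtain x y z f g where "f \<in> Hom J x y" "g \<in> Hom J y z"
      "i = a x" "k = a z" "u = b f" "v = b g"
      by (metis Hom_J'E a_eq)
    then show "Comp J' v u \<in> Hom J' i k"
      using Hom_J'I[OF J.Comp_in] by (simp add: J'_def Hom_Arr)
  next
    fix u i k assume "u \<in> Hom J' i k"
    then obtain x y f where f: "f \<in> Hom J x y" and "i = a x" "k = a y" "u = b f"
      by (metis Hom_J'E)
    then show "Comp J' u (Ident J' i) = u" "Comp J' (Ident J' k) u = u"
      by (simp_all add: J'_def Hom_Arr[OF f] Hom_Arr(1)[OF J.Ident_in] J.Comp_Ident[OF f]
            J.Ident_Comp[OF f])
  next
    fix u v w i j k l assume "u \<in> Hom J' i j" "v \<in> Hom J' j k" "w \<in> Hom J' k l"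
    then obtain x y z t f g h where fgh: "f \<in> Hom J x y" "g \<in> Hom J y z" "h \<in> Hom J z t"
      and "u = b f" "v = b g" "w = b h"
      by (metis Hom_J'E a_eq)
    then show "Comp J' w (Comp J' v u) = Comp J' (Comp J' w v) u"
      by (simp add: J'_def Hom_Arr[OF fgh(1)] Hom_Arr[OF fgh(2)] Hom_Arr[OF fgh(3)]
          Hom_Arr(1)[OF J.Comp_in[OF fgh(1,2)]] Hom_Arr(1)[OF J.Comp_in[OF fgh(2,3)]]
          J.Comp_assoc[OF fgh])
  qed (auto simp: J'_def J.Dom_in J.Cod_in)
  then interpret J': category J' .
  have "is_functor J' A D'"
  proof
    fix i assume "i \<in> Obj J'"
    then obtain x where x: "x \<in> Obj J" "i = a x" by (auto simp: J'_def)
    then show "OMap D' i \<in> Obj A" "AMap D' (Ident J' i) = Ident A (OMap D' i)"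
      by (simp_all add: D'_def J'_def OMap_in AMap_Ident Hom_Arr(1)[OF J.Ident_in])
  next
    fix u i k assume "u \<in> Hom J' i k"
    then obtain x y f where f: "f \<in> Hom J x y" and "i = a x" "k = a y" "u = b f"
      by (metis Hom_J'E)
    then show "AMap D' u \<in> Hom A (OMap D' i) (OMap D' k)"
      by (simp add: D'_def Hom_Arr[OF f] AMap_in[OF f])
  next
    fix u v i j k assume "u \<in> Hom J' i j" "v \<in> Hom J' j k"
    then obtain x y z f g where f: "f \<in> Hom J x y" and g: "g \<in> Hom J y z"
      and "u = b f" "v = b g"
      by (metis Hom_J'E a_eq)
    then show "AMap D' (Comp J' v u) = Comp A (AMap D' v) (AMap D' u)"
      by (simp add: D'_def J'_def Hom_Arr[OF f] Hom_Arr[OF g] Hom_Arr(1)[OF J.Comp_in[OF f g]]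
          AMap_Comp[OF f g])
  qed (simp_all add: D'_def J'_def)
  then obtain L \<phi> where L: "is_limit J' A D' L \<phi>"
    using complete unfolding complete_category_def by blast
  have cone: "is_cone J' A D' Z \<psi> \<longleftrightarrow> is_cone J A D Z (\<lambda>x. \<psi> (a x))" for Z \<psi>
    by (simp add: is_cone_def J'_def D'_def)
  have "is_limit J A D L (\<lambda>x. \<phi> (a x))"
    unfolding is_limit_def
  proof (intro conjI allI impI)
    show "is_cone J A D L (\<lambda>x. \<phi> (a x))"
      using L cone by (simp add: is_limit_def)
    fix Z \<psi> assume "is_cone J A D Z \<psi>"
    then have "is_cone J' A D' Z (\<lambda>i. \<psi> (a' i))"
      unfolding cone by (simp add: is_cone_def J.Dom_in J.Cod_in)
    then have "\<exists>!h. h \<in> Hom A Z L \<and> (\<forall>i\<in>Obj J'. Comp A (\<phi> i) h = \<psi> (a' i))"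
      using L by (simp add: is_limit_def)
    then show "\<exists>!h. h \<in> Hom A Z L \<and> (\<forall>x\<in>Obj J. Comp A (\<phi> (a x)) h = \<psi> x)"
      by (simp add: J'_def)
  qed
  then show ?thesis by blast
qed

lemma preorder_category_simps [simp]:
  "Obj (preorder_category Q s) = Q" "Arr (preorder_category Q s) = s"
  "Ident (preorder_category Q s) x = (x, x)"
  "Comp (preorder_category Q s) (y', z) (x, y) = (x, z)"
  by (simp_all add: preorder_category_def)

lemma Hom_preorder_category:
  "f \<in> Hom (preorder_category Q s) x y \<longleftrightarrow> f = (x, y) \<and> (x, y) \<in> s"
  by (auto simp: Hom_def preorder_category_def)

lemma category_preorder_category:
  assumes "preorder_on Q s"
  shows "category (preorder_category Q s)"
  using assms
  by unfold_locales
    (auto simp: preorder_category_def preorder_on_def refl_on_def Hom_def dest: transD)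

lemma is_cone_preorder_category:
  "is_cone (preorder_category Q s) A D Z \<psi> \<longleftrightarrow> Z \<in> Obj A \<and>
     (\<forall>x\<in>Q. \<psi> x \<in> Hom A Z (OMap D x)) \<and>
     (\<forall>x y. (x, y) \<in> s \<longrightarrow> Comp A (AMap D (x, y)) (\<psi> x) = \<psi> y)"
  by (auto simp: is_cone_def preorder_category_def)

lemma limit_cone_in_Hom:
  assumes "is_limit (preorder_category Q s) A D L \<phi>" and "x \<in> Q"
  shows "\<phi> x \<in> Hom A L (OMap D x)"
  using assms by (simp add: is_limit_def is_cone_preorder_category)

lemma limit_cone_compatible:
  assumes "is_limit (preorder_category Q s) A D L \<phi>" and "(x, y) \<in> s"
  shows "Comp A (AMap D (x, y)) (\<phi> x) = \<phi> y"
  using assms by (simp add: is_limit_def is_cone_preorder_category)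

lemma limit_factorization:
  assumes "is_limit (preorder_category Q s) A D L \<phi>"
    and "is_cone (preorder_category Q s) A D Z \<psi>"
  obtains h where "h \<in> Hom A Z L" and "\<And>x. x \<in> Q \<Longrightarrow> Comp A (\<phi> x) h = \<psi> x"
  proof -
  have "\<exists>!h. h \<in> Hom A Z L \<and> (\<forall>x\<in>Q. Comp A (\<phi> x) h = \<psi> x)"
    using assms by (simp add: is_limit_def)
  then show thesis using that by blast
qed

lemma limit_arrow_eqI:
  assumes A: "category A" and L: "is_limit (preorder_category Q s) A D L \<phi>"
    and s: "s \<subseteq> Q \<times> Q"
    and D: "\<And>x y. (x, y) \<in> s \<Longrightarrow> AMap D (x, y) \<in> Hom A (OMap D x) (OMap D y)"
    and h: "h \<in> Hom A Z L" "h' \<in> Hom A Z L"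
    and eq: "\<And>x. x \<in> Q \<Longrightarrow> Comp A (\<phi> x) h = Comp A (\<phi> x) h'"
  shows "h = h'"
proof -
  interpret category A by fact
  have "is_cone (preorder_category Q s) A D Z (\<lambda>x. Comp A (\<phi> x) h')"
    unfolding is_cone_preorder_category
  proof (intro conjI ballI allI impI)
    show "Z \<in> Obj A" using h(1) by (auto simp: Hom_def Dom_in)
  next
    fix x assume "x \<in> Q"
    then show "Comp A (\<phi> x) h' \<in> Hom A Z (OMap D x)"
      using Comp_in[OF h(2) limit_cone_in_Hom[OF L]] by blast
  next
    fix x y assume xy: "(x, y) \<in> s"
    then have "x \<in> Q" using s by auto
    from Comp_assoc[OF h(2) limit_cone_in_Hom[OF L this] D[OF xy]]
    show "Comp A (AMap D (x, y)) (Comp A (\<phi> x) h') = Comp A (\<phi> y) h'"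
      by (simp add: limit_cone_compatible[OF L xy])
  qed
  then have "\<exists>!k. k \<in> Hom A Z L \<and> (\<forall>x\<in>Q. Comp A (\<phi> x) k = Comp A (\<phi> x) h')"
    using L by (simp add: is_limit_def preorder_category_def)
  then show ?thesis using h eq by blast
qed

lemma times_lepoll_infinite:
  assumes "infinite (UNIV :: 'u set)" "I \<lesssim> (UNIV :: 'u set)" "K \<lesssim> (UNIV :: 'u set)"
  shows "I \<times> K \<lesssim> (UNIV :: 'u set)"
proof -
  have "(UNIV :: 'u set) \<times> (UNIV :: 'u set) \<approx> (UNIV :: 'u set)"
    unfolding eqpoll_def card_of_ordIso by (rule card_of_Times_same_infinite[OF assms(1)])
  with times_lepoll_mono[OF assms(2,3)] show ?thesis
    by (rule lepoll_trans2)
qed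

lemma preorder_limit_exists:
  fixes A :: "('o, 'm) cat"
  assumes complete: "complete_category TYPE('u) A" and inf: "infinite (UNIV :: 'u set)"
    and Q: "preorder_on Q s" "Q \<lesssim> (UNIV :: 'u set)"
    and D_Obj: "\<And>x. x \<in> Q \<Longrightarrow> OMap D x \<in> Obj A"
    and D_Arr: "\<And>x y. (x, y) \<in> s \<Longrightarrow> AMap D (x, y) \<in> Hom A (OMap D x) (OMap D y)"
    and D_Ident: "\<And>x. x \<in> Q \<Longrightarrow> AMap D (x, x) = Ident A (OMap D x)"
    and D_Comp: "\<And>x y z. \<lbrakk>(x, y) \<in> s; (y, z) \<in> s\<rbrakk>
                   \<Longrightarrow> AMap D (x, z) = Comp A (AMap D (y, z)) (AMap D (x, y))"
  shows "\<exists>L \<phi>. is_limit (preorder_category Q s) A D L \<phi>"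
proof -
  let ?J = "preorder_category Q s"
  interpret category A using complete by (simp add: complete_category_def)
  interpret J: category ?J by (rule category_preorder_category[OF Q(1)])
  have s: "s \<subseteq> Q \<times> Q" "\<And>x. x \<in> Q \<Longrightarrow> (x, x) \<in> s" "trans s"
    using Q(1) by (auto simp: preorder_on_def refl_on_def)
  define D' where "D' = \<lparr>OMap = restrict (OMap D) Q, AMap = restrict (AMap D) s\<rparr>"
  have "is_functor ?J A D'"
  proof
    fix f g x y z assume "f \<in> Hom ?J x y" "g \<in> Hom ?J y z"
    then have "f = (x, y)" "g = (y, z)" "(x, y) \<in> s" "(y, z) \<in> s" "(x, z) \<in> s"
      using s(3) by (auto simp: Hom_preorder_category dest: transD)
    then show "AMap D' (Comp ?J g f) = Comp A (AMap D' g) (AMap D' f)"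
      using D_Comp[of x y z] by (simp add: D'_def)
  qed (use s(1,2) D_Obj D_Arr D_Ident in \<open>auto simp: Hom_preorder_category D'_def\<close>)
  moreover have "Obj ?J \<lesssim> (UNIV :: 'u set)"
    using Q by (simp add: preorder_category_def)
  moreover have "Arr ?J \<lesssim> (UNIV :: 'u set)"
    using lepoll_trans[OF subset_imp_lepoll[OF s(1)] times_lepoll_infinite[OF inf Q(2) Q(2)]]
    by (simp add: preorder_category_def)
  ultimately obtain L \<phi> where "is_limit ?J A D' L \<phi>"
    using limit_exists_if_lepoll[OF complete] by blast
  moreover have "is_cone ?J A D' = is_cone ?J A D"
    by (auto simp: fun_eq_iff is_cone_def preorder_category_def D'_def)
  ultimately have "is_limit ?J A D L \<phi>"
    by (simp add: is_limit_def)
  then show ?thesis by blast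
qed

lemma product_exists:
  fixes A :: "('o, 'm) cat"
  assumes complete: "complete_category TYPE('u) A" and inf: "infinite (UNIV :: 'u set)"
    and I: "I \<lesssim> (UNIV :: 'u set)" and X: "\<And>i. i \<in> I \<Longrightarrow> X i \<in> Obj A"
  shows "\<exists>p \<pi>. is_product A I X p \<pi>"
proof -
  interpret category A using complete by (simp add: complete_category_def)
  let ?J = "preorder_category I (Id_on I)"
  let ?D = "\<lparr>OMap = X, AMap = \<lambda>(i, j). Ident A (X i)\<rparr>"
  have "\<exists>L \<phi>. is_limit ?J A ?D L \<phi>"
    by (rule preorder_limit_exists[OF complete inf _ I])
      (auto simp: preorder_on_def refl_on_def trans_def X Ident_in Comp_Ident[OF Ident_in])
  then obtain L \<phi> where "is_limit ?J A ?D L \<phi>" by blast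
  moreover have "is_cone ?J A ?D Z \<psi> \<longleftrightarrow> Z \<in> Obj A \<and> (\<forall>i\<in>I. \<psi> i \<in> Hom A Z (X i))" for Z \<psi>
    using Ident_Comp by (fastforce simp: is_cone_preorder_category)
  ultimately have "is_product A I X L \<phi>"
    unfolding is_limit_def is_product_def by (simp add: preorder_category_def)
  then show ?thesis by blast
qed

section \<open>Sheaves and gluing\<close>

lemma Hom_opposite_opens_category:
  "f \<in> Hom (opposite (opens_category X)) U V \<longleftrightarrow>
     f = (V, U) \<and> openin X U \<and> openin X V \<and> V \<subseteq> U"
  by (auto simp: Hom_def opposite_def opens_category_def preorder_category_def)

lemma Obj_opposite_opens_category: "U \<in> Obj (opposite (opens_category X)) \<longleftrightarrow> openin X U"
  by (simp add: opposite_def opens_category_def preorder_category_def)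

lemma Arr_opposite_opens_category:
  "(V, U) \<in> Arr (opposite (opens_category X)) \<longleftrightarrow> openin X U \<and> openin X V \<and> V \<subseteq> U"
  by (auto simp: opposite_def opens_category_def preorder_category_def)

lemma category_opposite:
  assumes "category C"
  shows "category (opposite C)"
proof -
  interpret category C by fact
  have Hom: "Hom (opposite C) x y = Hom C y x" for x y
    by (auto simp: Hom_def opposite_def)
  show ?thesis
    by unfold_locales
      (unfold Hom, auto simp: opposite_def Dom_in Cod_in Ident_in Comp_in Comp_Ident Ident_Comp
        Comp_assoc)
qed

lemma category_opposite_opens_category: "category (opposite (opens_category X))"
  unfolding opens_category_def
  by (intro category_opposite category_preorder_category)
    (auto simp: preorder_on_def refl_on_def trans_def)

locale presheaf = is_functor "opposite (opens_category X)" A F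
  for X :: "'p topology" and A :: "('o, 'm) cat" and F
begin

lemma obj_in: "openin X U \<Longrightarrow> OMap F U \<in> Obj A"
  by (simp add: OMap_in Obj_opposite_opens_category)

lemma res_in: "\<lbrakk>openin X U; openin X V; V \<subseteq> U\<rbrakk> \<Longrightarrow> AMap F (V, U) \<in> Hom A (OMap F U) (OMap F V)"
  by (simp add: AMap_in Hom_opposite_opens_category)

lemma res_self: "openin X U \<Longrightarrow> AMap F (U, U) = Ident A (OMap F U)"
  using AMap_Ident[of U] unfolding Obj_opposite_opens_category
  by (simp add: opposite_def opens_category_def preorder_category_def)

lemma res_res:
  "\<lbrakk>openin X U; openin X V; openin X W; W \<subseteq> V; V \<subseteq> U\<rbrakk>
     \<Longrightarrow> Comp A (AMap F (W, V)) (AMap F (V, U)) = AMap F (W, U)"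
  using AMap_Comp[of "(V, U)" U V "(W, V)" W] unfolding Hom_opposite_opens_category
  by (simp add: opposite_def opens_category_def preorder_category_def)

lemma res_res_comp:
  assumes "openin X U" "openin X V" "openin X W" "W \<subseteq> V" "V \<subseteq> U" "h \<in> Hom A Z (OMap F U)"
  shows "Comp A (AMap F (W, V)) (Comp A (AMap F (V, U)) h) = Comp A (AMap F (W, U)) h"
  using D.Comp_assoc[OF assms(6) res_in[OF assms(1,2,5)] res_in[OF assms(2,3,4)]]
  by (simp add: res_res[OF assms(1-5)])

end

text \<open>
  The sheaf condition in terms of generalized sections: an arrow from \<open>Z\<close> to \<open>F(U)\<close> is a section of \<open>F\<close>
  over \<open>U\<close> parametrized by \<open>Z\<close>.
\<close>

definition matching_family ::
  "('o, 'm) cat \<Rightarrow> ('p set, 'p set \<times> 'p set, 'o, 'm) funct \<Rightarrow> 'p set set \<Rightarrow> 'o \<Rightarrow>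
     ('p set \<Rightarrow> 'm) \<Rightarrow> bool"
where
  "matching_family A F \<U> Z \<psi> \<longleftrightarrow> Z \<in> Obj A \<and>
     (\<forall>V\<in>\<U>. \<psi> V \<in> Hom A Z (OMap F V)) \<and>
     (\<forall>V\<in>\<U>. \<forall>W\<in>\<U>.
        Comp A (AMap F (V \<inter> W, V)) (\<psi> V) = Comp A (AMap F (V \<inter> W, W)) (\<psi> W))"

definition glues ::
  "'p topology \<Rightarrow> ('o, 'm) cat \<Rightarrow> ('p set, 'p set \<times> 'p set, 'o, 'm) funct \<Rightarrow> bool"
where
  "glues X A F \<longleftrightarrow>
     (\<forall>\<U> Z \<psi>. (\<forall>V\<in>\<U>. openin X V) \<and> matching_family A F \<U> Z \<psi> \<longrightarrow>
        (\<exists>!h. h \<in> Hom A Z (OMap F (\<Union>\<U>)) \<and> (\<forall>V\<in>\<U>. Comp A (AMap F (V, \<Union>\<U>)) h = \<psi> V)))"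

lemma glues_unique:
  assumes "glues X A F" "\<And>V. V \<in> \<U> \<Longrightarrow> openin X V" "matching_family A F \<U> Z \<psi>" "\<Union>\<U> = U"
  shows "\<exists>!h. h \<in> Hom A Z (OMap F U) \<and> (\<forall>V\<in>\<U>. Comp A (AMap F (V, U)) h = \<psi> V)"
proof -
  have "\<exists>!h. h \<in> Hom A Z (OMap F (\<Union>\<U>)) \<and> (\<forall>V\<in>\<U>. Comp A (AMap F (V, \<Union>\<U>)) h = \<psi> V)"
    by (rule assms(1)[unfolded glues_def, rule_format]) (simp add: assms(2,3))
  then show ?thesis by (simp only: assms(4))
qed

lemma matching_family_agree:
  assumes "matching_family A F \<U> Z \<psi>" "V \<in> \<U>" "W \<in> \<U>"
  shows "Comp A (AMap F (V \<inter> W, V)) (\<psi> V) = Comp A (AMap F (V \<inter> W, W)) (\<psi> W)"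
  by (rule assms(1)[unfolded matching_family_def, THEN conjunct2, THEN conjunct2, rule_format,
      OF assms(2,3)])

lemma product_factorization:
  assumes "is_product A I X p \<pi>" "Z \<in> Obj A" "\<And>i. i \<in> I \<Longrightarrow> \<psi> i \<in> Hom A Z (X i)"
  obtains h where "h \<in> Hom A Z p" and "\<And>i. i \<in> I \<Longrightarrow> Comp A (\<pi> i) h = \<psi> i"
proof -
  have "\<exists>!h. h \<in> Hom A Z p \<and> (\<forall>i \<in> I. Comp A (\<pi> i) h = \<psi> i)"
    using assms by (simp add: is_product_def)
  then show thesis using that by blast
qed

lemma product_arrow_eqI:
  assumes "category A" "is_product A I X p \<pi>" "f \<in> Hom A Z p" "g \<in> Hom A Z p"
    and "\<And>i. i \<in> I \<Longrightarrow> Comp A (\<pi> i) f = Comp A (\<pi> i) g"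
  shows "f = g"
proof -
  interpret category A by fact
  have Z: "Z \<in> Obj A" using assms(3) by (auto simp: Hom_def Dom_in)
  have "\<pi> i \<in> Hom A p (X i)" if "i \<in> I" for i
    using assms(2) that by (simp add: is_product_def)
  then have "Comp A (\<pi> i) g \<in> Hom A Z (X i)" if "i \<in> I" for i
    using that Comp_in[OF assms(4)] by blast
  then have "\<exists>!h. h \<in> Hom A Z p \<and> (\<forall>i \<in> I. Comp A (\<pi> i) h = Comp A (\<pi> i) g)"
    using assms(2) Z by (simp add: is_product_def)
  then show ?thesis using assms(3-5) by blast
qed

lemma equalizer_factorization:
  assumes "is_equalizer A s t e" "s \<in> Hom A p q" "e \<in> Hom A E p" "k \<in> Hom A Z p"
    and "Comp A s k = Comp A t k"
  shows "\<exists>!h. h \<in> Hom A Z E \<and> Comp A e h = k"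
proof -
  have [simp]: "k \<in> Arr A" "Cod A k = p" "Dom A k = Z" "Dom A s = p" "Dom A e = E"
    using assms(2-4) by (simp_all add: Hom_def)
  have "\<forall>k\<in>Arr A. Cod A k = Dom A s \<and> Comp A s k = Comp A t k \<longrightarrow>
      (\<exists>!h. h \<in> Hom A (Dom A k) (Dom A e) \<and> Comp A e h = k)"
    using assms(1) unfolding is_equalizer_def by (elim conjE)
  from bspec[OF this, of k] assms(5) show ?thesis by simp
qed

lemma is_equalizerI:
  assumes "s \<in> Hom A p q" "t \<in> Hom A p q" "e \<in> Hom A E p" "Comp A s e = Comp A t e"
    and "\<And>Z k. \<lbrakk>k \<in> Hom A Z p; Comp A s k = Comp A t k\<rbrakk>
           \<Longrightarrow> \<exists>!h. h \<in> Hom A Z E \<and> Comp A e h = k"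
  shows "is_equalizer A s t e"
proof -
  have *: "Dom A s = p" "Cod A s = q" "s \<in> Arr A" "e \<in> Arr A" "Cod A e = p" "Dom A e = E"
    using assms(1,3) by (simp_all add: Hom_def)
  have "\<exists>!h. h \<in> Hom A (Dom A k) E \<and> Comp A e h = k"
    if "k \<in> Arr A" "Cod A k = p" "Comp A s k = Comp A t k" for k
    using assms(5)[of k "Dom A k"] that by (simp add: Hom_def)
  then show ?thesis
    unfolding is_equalizer_def * using assms(2,4) *(3,4) by (intro conjI ballI impI) simp_all
qed

text \<open>
  An arrow from \<open>Z\<close> to the product of the \<open>F(V)\<close> is a family of arrows \<open>\<psi> V\<close>, and it equalizes the two
  arrows into the product of the \<open>F(V \<inter> W)\<close> exactly if the family is matching.
\<close>

lemma is_sheaf_imp_glues: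
  assumes "presheaf X A F" and sheaf: "is_sheaf X A F"
  shows "glues X A F"
  unfolding glues_def
proof (intro allI impI, elim conjE)
  fix \<U> Z \<psi> assume \<U>: "\<forall>V\<in>\<U>. openin X V" and \<psi>: "matching_family A F \<U> Z \<psi>"
  interpret A: category A using assms(1) by (simp add: presheaf_def is_functor_def)
  interpret presheaf X A F by fact
  let ?U = "\<Union>\<U>"
  have U: "openin X ?U" using \<U> by blast
  obtain p \<pi> q \<rho> e s t where
    p: "is_product A \<U> (OMap F) p \<pi>" and
    q: "is_product A (\<U> \<times> \<U>) (\<lambda>(V, W). OMap F (V \<inter> W)) q \<rho>" and
    e: "e \<in> Hom A (OMap F ?U) p" and st: "s \<in> Hom A p q" "t \<in> Hom A p q" and
    \<pi>e: "\<And>V. V \<in> \<U> \<Longrightarrow> Comp A (\<pi> V) e = AMap F (V, ?U)" and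
    \<rho>s: "\<And>V W. V \<in> \<U> \<Longrightarrow> W \<in> \<U> \<Longrightarrow> Comp A (\<rho> (V, W)) s = Comp A (AMap F (V \<inter> W, V)) (\<pi> V)" and
    \<rho>t: "\<And>V W. V \<in> \<U> \<Longrightarrow> W \<in> \<U> \<Longrightarrow> Comp A (\<rho> (V, W)) t = Comp A (AMap F (V \<inter> W, W)) (\<pi> W)" and
    eq: "is_equalizer A s t e"
    using sheaf[unfolded is_sheaf_def, rule_format, of ?U \<U>] U \<U> by blast
  have \<pi>: "\<pi> V \<in> Hom A p (OMap F V)" if "V \<in> \<U>" for V
    using p that by (simp add: is_product_def)
  have \<rho>: "\<rho> (V, W) \<in> Hom A q (OMap F (V \<inter> W))" if "V \<in> \<U>" "W \<in> \<U>" for V W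
    using q that by (auto simp: is_product_def)
  obtain k where k: "k \<in> Hom A Z p" and \<pi>k: "\<And>V. V \<in> \<U> \<Longrightarrow> Comp A (\<pi> V) k = \<psi> V"
    using product_factorization[OF p, of Z \<psi>] \<psi> by (auto simp: matching_family_def)
  have "Comp A s k = Comp A t k"
  proof (rule product_arrow_eqI[OF A.category_axioms q A.Comp_in[OF k st(1)] A.Comp_in[OF k st(2)]])
    fix i assume "i \<in> \<U> \<times> \<U>"
    then obtain V W where i: "i = (V, W)" and V: "V \<in> \<U>" and W: "W \<in> \<U>" by blast
    have VW: "openin X V" "openin X W" "openin X (V \<inter> W)" using \<U> V W by auto
    have "Comp A (\<rho> (V, W)) (Comp A s k) = Comp A (AMap F (V \<inter> W, V)) (\<psi> V)"
      using A.Comp_assoc[OF k st(1) \<rho>[OF V W]] A.Comp_assoc[OF k \<pi>[OF V] res_in] VW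
      by (simp add: \<rho>s[OF V W] \<pi>k[OF V])
    also have "\<dots> = Comp A (AMap F (V \<inter> W, W)) (\<psi> W)"
      by (rule matching_family_agree[OF \<psi> V W])
    also have "\<dots> = Comp A (\<rho> (V, W)) (Comp A t k)"
      using A.Comp_assoc[OF k st(2) \<rho>[OF V W]] A.Comp_assoc[OF k \<pi>[OF W] res_in] VW
      by (simp add: \<rho>t[OF V W] \<pi>k[OF W])
    finally show "Comp A (\<rho> i) (Comp A s k) = Comp A (\<rho> i) (Comp A t k)" by (simp add: i)
  qed
  then have ex1: "\<exists>!h. h \<in> Hom A Z (OMap F ?U) \<and> Comp A e h = k"
    by (rule equalizer_factorization[OF eq st(1) e k])
  have "h \<in> Hom A Z (OMap F ?U) \<and> (\<forall>V\<in>\<U>. Comp A (AMap F (V, ?U)) h = \<psi> V) \<longleftrightarrow>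
        h \<in> Hom A Z (OMap F ?U) \<and> Comp A e h = k" for h
  proof (intro conj_cong refl iffI ballI)
    assume h: "h \<in> Hom A Z (OMap F ?U)"
    have \<pi>eh: "Comp A (\<pi> V) (Comp A e h) = Comp A (AMap F (V, ?U)) h" if "V \<in> \<U>" for V
      using A.Comp_assoc[OF h e \<pi>[OF that]] by (simp add: \<pi>e that)
    show "Comp A e h = k" if "\<forall>V\<in>\<U>. Comp A (AMap F (V, ?U)) h = \<psi> V"
      by (rule product_arrow_eqI[OF A.category_axioms p A.Comp_in[OF h e] k])
         (simp add: \<pi>eh \<pi>k that)
    show "Comp A (AMap F (V, ?U)) h = \<psi> V" if "Comp A e h = k" "V \<in> \<U>" for V
      using \<pi>eh[OF that(2)] by (simp add: that \<pi>k)
  qed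
  with ex1 show "\<exists>!h. h \<in> Hom A Z (OMap F ?U) \<and> (\<forall>V\<in>\<U>. Comp A (AMap F (V, ?U)) h = \<psi> V)"
    by simp
qed

text \<open>
  Completeness supplies the two products, and gluing says that \<open>F(U)\<close> is the equalizer.
\<close>

lemma glues_imp_is_sheaf:
  fixes A :: "('o, 'm) cat"
  assumes complete: "complete_category TYPE('u) A" and inf: "infinite (UNIV :: 'u set)"
    and small: "{U. openin X U} \<lesssim> (UNIV :: 'u set)"
    and "presheaf X A F" and glues: "glues X A F"
  shows "is_sheaf X A F"
  unfolding is_sheaf_def
proof (intro allI impI, elim conjE)
  fix U \<U> assume U: "openin X U" and \<U>: "\<forall>V\<in>\<U>. openin X V" and Union: "\<Union>\<U> = U"
  interpret A: category A using complete by (simp add: complete_category_def)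
  interpret presheaf X A F by fact
  have sub: "V \<subseteq> U" if "V \<in> \<U>" for V using Union that by blast
  have le: "\<U> \<lesssim> (UNIV :: 'u set)"
    using \<U> lepoll_trans[OF subset_imp_lepoll small] by blast
  obtain p \<pi> where p: "is_product A \<U> (OMap F) p \<pi>"
    using product_exists[OF complete inf le, of "OMap F"] \<U> obj_in by metis
  have "\<exists>q \<rho>. is_product A (\<U> \<times> \<U>) (\<lambda>(V, W). OMap F (V \<inter> W)) q \<rho>"
    using \<U> by (intro product_exists[OF complete inf times_lepoll_infinite[OF inf le le]])
      (auto intro: obj_in)
  then obtain q \<rho> where q: "is_product A (\<U> \<times> \<U>) (\<lambda>(V, W). OMap F (V \<inter> W)) q \<rho>" by blast
  have \<pi>: "\<pi> V \<in> Hom A p (OMap F V)" if "V \<in> \<U>" for V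
    using p that by (simp add: is_product_def)
  have \<rho>: "\<rho> (V, W) \<in> Hom A q (OMap F (V \<inter> W))" if "V \<in> \<U>" "W \<in> \<U>" for V W
    using q that by (auto simp: is_product_def)
  have p_in: "p \<in> Obj A" using p by (simp add: is_product_def)
  obtain e where e: "e \<in> Hom A (OMap F U) p"
    and \<pi>e: "\<And>V. V \<in> \<U> \<Longrightarrow> Comp A (\<pi> V) e = AMap F (V, U)"
    using product_factorization[OF p obj_in[OF U], of "\<lambda>V. AMap F (V, U)"] \<U> U sub res_in by metis
  define \<sigma> where "\<sigma> = (\<lambda>(V, W). Comp A (AMap F (V \<inter> W, V)) (\<pi> V))"
  have \<sigma>_in: "\<sigma> i
      \<in> Hom A p ((\<lambda>(V, W). OMap F (V \<inter> W)) i)" if i: "i \<in> \<U> \<times> \<U>" for i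
  proof -
    obtain V W where VW: "i = (V, W)" "V \<in> \<U>" "W \<in> \<U>" using i by blast
    then have "openin X V" "openin X W" "openin X (V \<inter> W)" using \<U> by auto
    then show ?thesis using A.Comp_in[OF \<pi>[OF VW(2)] res_in, of "V \<inter> W"] by (simp add: VW(1) \<sigma>_def)
  qed
  obtain s where s: "s \<in> Hom A p q" and *: "\<And>i. i \<in> \<U> \<times> \<U> \<Longrightarrow>
      Comp A (\<rho> i) s = \<sigma> i"
    using product_factorization[OF q p_in \<sigma>_in] by blast
  have \<rho>s: "Comp A (\<rho> (V, W)) s = Comp A (AMap F (V \<inter> W, V)) (\<pi> V)"
    if "V \<in> \<U>" "W \<in> \<U>" for V W
    using *[of "(V, W)"] that by (simp add: \<sigma>_def)
  define \<tau> where "\<tau> = (\<lambda>(V, W). Comp A (AMap F (V \<inter> W, W)) (\<pi> W))"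
  have \<tau>_in: "\<tau> i
      \<in> Hom A p ((\<lambda>(V, W). OMap F (V \<inter> W)) i)" if i: "i \<in> \<U> \<times> \<U>" for i
  proof -
    obtain V W where VW: "i = (V, W)" "V \<in> \<U>" "W \<in> \<U>" using i by blast
    then have "openin X V" "openin X W" "openin X (V \<inter> W)" using \<U> by auto
    then show ?thesis using A.Comp_in[OF \<pi>[OF VW(3)] res_in, of "V \<inter> W"] by (simp add: VW(1) \<tau>_def)
  qed
  obtain t where t: "t \<in> Hom A p q" and *: "\<And>i. i \<in> \<U> \<times> \<U> \<Longrightarrow>
      Comp A (\<rho> i) t = \<tau> i"
    using product_factorization[OF q p_in \<tau>_in] by blast
  have \<rho>t: "Comp A (\<rho> (V, W)) t = Comp A (AMap F (V \<inter> W, W)) (\<pi> W)"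
    if "V \<in> \<U>" "W \<in> \<U>" for V W
    using *[of "(V, W)"] that by (simp add: \<tau>_def)
  have \<rho>s_comp: "Comp A (\<rho> (V, W)) (Comp A s k) = Comp A (AMap F (V \<inter> W, V)) (Comp A (\<pi> V) k)"
    and \<rho>t_comp: "Comp A (\<rho> (V, W)) (Comp A t k) = Comp A (AMap F (V \<inter> W, W)) (Comp A (\<pi> W) k)"
    if k: "k \<in> Hom A Z p" and V: "V \<in> \<U>" and W: "W \<in> \<U>" for Z k V W
  proof -
    have VW: "openin X V" "openin X W" "openin X (V \<inter> W)" using \<U> V W by auto
    show "Comp A (\<rho> (V, W)) (Comp A s k) = Comp A (AMap F (V \<inter> W, V)) (Comp A (\<pi> V) k)"
      using A.Comp_assoc[OF k s \<rho>[OF V W]] A.Comp_assoc[OF k \<pi>[OF V] res_in] VW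
      by (simp add: \<rho>s[OF V W])
    show "Comp A (\<rho> (V, W)) (Comp A t k) = Comp A (AMap F (V \<inter> W, W)) (Comp A (\<pi> W) k)"
      using A.Comp_assoc[OF k t \<rho>[OF V W]] A.Comp_assoc[OF k \<pi>[OF W] res_in] VW
      by (simp add: \<rho>t[OF V W])
  qed
  have equalizer: "is_equalizer A s t e"
  proof (rule is_equalizerI[OF s t e])
    show "Comp A s e = Comp A t e"
    proof (rule product_arrow_eqI[OF A.category_axioms q A.Comp_in[OF e s] A.Comp_in[OF e t]])
      fix i assume "i \<in> \<U> \<times> \<U>"
      then obtain V W where i: "i = (V, W)" and V: "V \<in> \<U>" and W: "W \<in> \<U>" by blast
      then have "openin X V" "openin X W" "openin X (V \<inter> W)" using \<U> by auto
      then show "Comp A (\<rho> i) (Comp A s e) = Comp A (\<rho> i) (Comp A t e)"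
        by (simp add: i \<rho>s_comp[OF e V W] \<rho>t_comp[OF e V W] \<pi>e V W res_res U sub)
    qed
  next
    fix Z k assume k: "k \<in> Hom A Z p" and eq: "Comp A s k = Comp A t k"
    have "matching_family A F \<U> Z (\<lambda>V. Comp A (\<pi> V) k)"
      unfolding matching_family_def
    proof (intro conjI ballI)
      show "Z \<in> Obj A" using k A.Dom_in by (auto simp: Hom_def)
    next
      fix V assume "V \<in> \<U>"
      then show "Comp A (\<pi> V) k \<in> Hom A Z (OMap F V)" by (rule A.Comp_in[OF k \<pi>])
    next
      fix V W assume VW: "V \<in> \<U>" "W \<in> \<U>"
      show "Comp A (AMap F (V \<inter> W, V)) (Comp A (\<pi> V) k) =
            Comp A (AMap F (V \<inter> W, W)) (Comp A (\<pi> W) k)"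
        using \<rho>s_comp[OF k VW] \<rho>t_comp[OF k VW] eq by simp
    qed
    then have ex1: "\<exists>!h. h \<in> Hom A Z (OMap F U) \<and>
        (\<forall>V\<in>\<U>. Comp A (AMap F (V, U)) h = Comp A (\<pi> V) k)"
      using glues \<U> Union unfolding glues_def by blast
    have "h \<in> Hom A Z (OMap F U) \<and>
        (\<forall>V\<in>\<U>. Comp A (AMap F (V, U)) h = Comp A (\<pi> V) k) \<longleftrightarrow>
        h \<in> Hom A Z (OMap F U) \<and> Comp A e h = k" for h
    proof (intro conj_cong refl iffI ballI)
      assume h: "h \<in> Hom A Z (OMap F U)"
      have \<pi>eh: "Comp A (\<pi> V) (Comp A e h) = Comp A (AMap F (V, U)) h" if "V \<in> \<U>" for V
        using A.Comp_assoc[OF h e \<pi>[OF that]] by (simp add: \<pi>e that)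
      show "Comp A e h = k" if "\<forall>V\<in>\<U>. Comp A (AMap F (V, U)) h = Comp A (\<pi> V) k"
        by (rule product_arrow_eqI[OF A.category_axioms p A.Comp_in[OF h e] k])
           (simp add: \<pi>eh that)
      show "Comp A (AMap F (V, U)) h = Comp A (\<pi> V) k" if "Comp A e h = k" "V \<in> \<U>" for V
        using \<pi>eh[OF that(2)] by (simp add: that)
    qed
    with ex1 show "\<exists>!h. h \<in> Hom A Z (OMap F U) \<and> Comp A e h = k" by simp
  qed
  show "\<exists>p \<pi> q \<rho> e s t.
      is_product A \<U> (OMap F) p \<pi> \<and>
      is_product A (\<U> \<times> \<U>) (\<lambda>(V, W). OMap F (V \<inter> W)) q \<rho> \<and>
      e \<in> Hom A (OMap F U) p \<and> s \<in> Hom A p q \<and> t \<in> Hom A p q \<and>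
      (\<forall>V\<in>\<U>. Comp A (\<pi> V) e = AMap F (V, U)) \<and>
      (\<forall>V\<in>\<U>. \<forall>W\<in>\<U>.
         Comp A (\<rho> (V, W)) s = Comp A (AMap F (V \<inter> W, V)) (\<pi> V) \<and>
         Comp A (\<rho> (V, W)) t = Comp A (AMap F (V \<inter> W, W)) (\<pi> W)) \<and>
      is_equalizer A s t e"
    by (intro exI[of _ p] exI[of _ \<pi>] exI[of _ q] exI[of _ \<rho>] exI[of _ e] exI[of _ s] exI[of _ t]
          conjI ballI p q e s t \<pi>e \<rho>s \<rho>t equalizer)
qed

section \<open>Sheaves on an Alexandrov space are determined by their stalks\<close>

locale alexandrov_space =
  fixes P :: "'p set" and r :: "'p rel" and A :: "('o, 'm) cat"
  assumes preorder: "preorder_on P r" and category: "category A"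
begin

sublocale A: category A by (rule category)

abbreviation up :: "'p \<Rightarrow> 'p set" where "up \<equiv> up_set P r"
abbreviation X :: "'p topology" where "X \<equiv> alexandrov P r"
abbreviation sub :: "'p set \<Rightarrow> ('p, 'p \<times> 'p) cat" where "sub U \<equiv> preorder_category U (Restr r U)"

lemma r_refl: "p \<in> P \<Longrightarrow> (p, p) \<in> r"
  and r_trans: "\<lbrakk>(p, q) \<in> r; (q, x) \<in> r\<rbrakk> \<Longrightarrow> (p, x) \<in> r"
  and r_field: "(p, q) \<in> r \<Longrightarrow> p \<in> P \<and> q \<in> P"
  using preorder by (auto simp: preorder_on_def refl_on_def dest: transD)

lemma open_subset: "openin X U \<Longrightarrow> U \<subseteq> P"
  and open_upward: "\<lbrakk>openin X U; p \<in> U; (p, q) \<in> r\<rbrakk> \<Longrightarrow> q \<in> U"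
  by (auto simp: openin_alexandrov[OF preorder])

lemma in_up_iff: "q \<in> up p \<longleftrightarrow> (p, q) \<in> r"
  using r_field by (auto simp: up_set_def)

lemma self_in_up: "p \<in> P \<Longrightarrow> p \<in> up p"
  by (simp add: in_up_iff r_refl)

lemma open_up: "openin X (up p)"
  unfolding openin_alexandrov[OF preorder] using r_trans r_field by (auto simp: in_up_iff)

lemma up_mono: "(p, q) \<in> r \<Longrightarrow> up q \<subseteq> up p"
  using r_trans by (auto simp: in_up_iff)

lemma up_subset: "\<lbrakk>openin X U; p \<in> U\<rbrakk> \<Longrightarrow> up p \<subseteq> U"
  using open_upward by (auto simp: in_up_iff)

lemma preorder_on_Restr: "U \<subseteq> P \<Longrightarrow> preorder_on U (Restr r U)"
  using r_refl r_trans by (auto simp: preorder_on_def refl_on_def trans_def)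

text \<open>
  The open sets containing \<open>p\<close> have a least element \<open>up p\<close>, so that the stalk of \<open>F\<close> at \<open>p\<close>, the colimit
  of \<open>F\<close> over these open sets, is \<open>F(up p)\<close>.
\<close>

definition stalks ::
  "('p set, 'p set \<times> 'p set, 'o, 'm) funct \<Rightarrow> ('p, 'p \<times> 'p, 'o, 'm) funct"
where
  "stalks F = \<lparr>OMap = (\<lambda>p\<in>P. OMap F (up p)), AMap = restrict (\<lambda>(p, q). AMap F (up q, up p)) r\<rparr>"

lemma OMap_stalks: "p \<in> P \<Longrightarrow> OMap (stalks F) p = OMap F (up p)"
  and AMap_stalks: "(p, q) \<in> r \<Longrightarrow> AMap (stalks F) (p, q) = AMap F (up q, up p)"
  by (simp_all add: stalks_def)

lemma functor_stalks:
  assumes "presheaf X A F"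
  shows "is_functor (preorder_category P r) A (stalks F)"
proof -
  interpret presheaf X A F by fact
  interpret J: category "preorder_category P r" by (rule category_preorder_category[OF preorder])
  show ?thesis
  proof
    fix p assume "p \<in> Obj (preorder_category P r)"
    then show "OMap (stalks F) p \<in> Obj A"
      and "AMap (stalks F) (Ident (preorder_category P r) p) = Ident A (OMap (stalks F) p)"
      by (simp_all add: OMap_stalks AMap_stalks obj_in open_up r_refl res_self)
  next
    fix f p q assume "f \<in> Hom (preorder_category P r) p q"
    then have pq: "f = (p, q)" "(p, q) \<in> r" by (simp_all add: Hom_preorder_category)
    show "AMap (stalks F) f \<in> Hom A (OMap (stalks F) p) (OMap (stalks F) q)"
      using r_field[OF pq(2)] res_in[OF open_up open_up up_mono[OF pq(2)]]
      by (simp add: pq AMap_stalks OMap_stalks)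
  next
    fix f g p q x
    assume "f \<in> Hom (preorder_category P r) p q" "g \<in> Hom (preorder_category P r) q x"
    then have fg: "f = (p, q)" "(p, q) \<in> r" "g = (q, x)" "(q, x) \<in> r"
      by (simp_all add: Hom_preorder_category)
    show "AMap (stalks F) (Comp (preorder_category P r) g f) =
          Comp A (AMap (stalks F) g) (AMap (stalks F) f)"
      using res_res[OF open_up open_up open_up up_mono[OF fg(4)] up_mono[OF fg(2)]]
        r_trans[OF fg(2,4)]
      by (simp add: fg AMap_stalks)
  qed (simp_all add: stalks_def)
qed

lemma cellular_stalks:
  assumes "presheaf X A F"
  shows "is_cellular_sheaf r A (stalks F)"
  unfolding is_cellular_sheaf_def
proof (intro allI impI)
  fix p q assume pq: "(p, q) \<in> r \<and> (q, p) \<in> r"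
  interpret presheaf X A F by fact
  have "up p = up q" using pq up_mono by blast
  then show "OMap (stalks F) p = OMap (stalks F) q \<and>
      AMap (stalks F) (p, q) = Ident A (OMap (stalks F) p) \<and>
      AMap (stalks F) (q, p) = Ident A (OMap (stalks F) p)"
    using pq r_field[of p q] by (simp add: OMap_stalks AMap_stalks res_self open_up)
qed

text \<open>\<open>F\<close> is the right Kan extension of its stalks along \<open>p \<mapsto> up p\<close>.\<close>

definition stalkwise :: "('p set, 'p set \<times> 'p set, 'o, 'm) funct \<Rightarrow> bool" where
  "stalkwise F \<longleftrightarrow>
     (\<forall>U. openin X U \<longrightarrow> is_limit (sub U) A (stalks F) (OMap F U) (\<lambda>p. AMap F (up p, U)))"

lemma restrictions_cone:
  assumes "presheaf X A F" and U: "openin X U"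
  shows "is_cone (sub U) A (stalks F) (OMap F U) (\<lambda>p. AMap F (up p, U))"
  unfolding is_cone_preorder_category
proof (intro conjI ballI allI impI)
  interpret presheaf X A F by fact
  show "OMap F U \<in> Obj A" by (rule obj_in[OF U])
  show "AMap F (up p, U) \<in> Hom A (OMap F U) (OMap (stalks F) p)" if "p \<in> U" for p
    using that res_in[OF U open_up up_subset[OF U that]] open_subset[OF U]
    by (auto simp: OMap_stalks)
  show "Comp A (AMap (stalks F) (p, q)) (AMap F (up p, U)) = AMap F (up q, U)"
    if "(p, q) \<in> Restr r U" for p q
    using that res_res[OF U open_up open_up up_mono up_subset[OF U]] by (simp add: AMap_stalks)
qed

lemma stalkwise_eqI:
  assumes "presheaf X A F" and "stalkwise F" and U: "openin X U"
    and h: "h \<in> Hom A Z (OMap F U)" "h' \<in> Hom A Z (OMap F U)"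
    and eq: "\<And>p. p \<in> U \<Longrightarrow> Comp A (AMap F (up p, U)) h = Comp A (AMap F (up p, U)) h'"
  shows "h = h'"
proof (rule limit_arrow_eqI[OF category _ _ _ h eq])
  show "is_limit (sub U) A (stalks F) (OMap F U) (\<lambda>p. AMap F (up p, U))"
    using assms by (simp add: stalkwise_def)
  interpret presheaf X A F by fact
  show "AMap (stalks F) (p, q) \<in> Hom A (OMap (stalks F) p) (OMap (stalks F) q)"
    if "(p, q) \<in> Restr r U" for p q
    using that r_field[of p q] res_in[OF open_up open_up up_mono, of p q]
    by (simp add: AMap_stalks OMap_stalks)
qed auto

text \<open>
  Gluing is unique on the cover of \<open>U\<close> by the sets \<open>up p\<close>, hence sections are equal if their stalks are.
\<close>

lemma glues_eqI:
  assumes "presheaf X A F" and glues: "glues X A F" and U: "openin X U"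
    and h: "h \<in> Hom A Z (OMap F U)" "h' \<in> Hom A Z (OMap F U)"
    and eq: "\<And>p. p \<in> U \<Longrightarrow> Comp A (AMap F (up p, U)) h = Comp A (AMap F (up p, U)) h'"
  shows "h = h'"
proof -
  interpret presheaf X A F by fact
  have Union: "\<Union>(up ` U) = U"
    using up_subset[OF U] self_in_up open_subset[OF U] by blast
  have "matching_family A F (up ` U) Z (\<lambda>V. Comp A (AMap F (V, U)) h')"
    unfolding matching_family_def
  proof (intro conjI ballI)
    show "Z \<in> Obj A" using h(1) A.Dom_in by (auto simp: Hom_def)
  next
    fix V assume "V \<in> up ` U"
    then show "Comp A (AMap F (V, U)) h' \<in> Hom A Z (OMap F V)"
      using A.Comp_in[OF h(2) res_in[OF U open_up up_subset[OF U]]] by blast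
  next
    fix V W assume "V \<in> up ` U" "W \<in> up ` U"
    then have VW: "openin X V" "V \<subseteq> U" "openin X W" "W \<subseteq> U" "openin X (V \<inter> W)"
      using up_subset[OF U] open_up by auto
    show "Comp A (AMap F (V \<inter> W, V)) (Comp A (AMap F (V, U)) h') =
          Comp A (AMap F (V \<inter> W, W)) (Comp A (AMap F (W, U)) h')"
      by (simp add: res_res_comp[OF U VW(1,5) _ VW(2) h(2)] res_res_comp[OF U VW(3,5) _ VW(4) h(2)])
  qed
  from glues_unique[OF glues _ this Union]
  have "\<exists>!k. k \<in> Hom A Z (OMap F U) \<and>
      (\<forall>V\<in>up ` U. Comp A (AMap F (V, U)) k = Comp A (AMap F (V, U)) h')"
    using open_up by blast
  then show ?thesis using h eq by blast
qed

text \<open>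
  A cone over the stalks at the points of \<open>U\<close> is the same as a matching family on the cover of \<open>U\<close> by
  the sets \<open>up p\<close>: equivalent points have the same \<open>up p\<close> but also equal components of the cone, and
  agreement on the overlap \<open>up p \<inter> up q\<close> can be tested on the stalks at its points \<open>x\<close>, where both
  restrictions are the component of the cone at \<open>x\<close>.
\<close>

lemma glues_imp_stalkwise:
  assumes "presheaf X A F" and glues: "glues X A F"
  shows "stalkwise F"
  unfolding stalkwise_def is_limit_def
proof (intro allI impI conjI restrictions_cone[OF assms(1)])
  fix U Z \<psi> assume U: "openin X U" and cone: "is_cone (sub U) A (stalks F) Z \<psi>"
  interpret presheaf X A F by fact
  have UP: "p \<in> P" if "p \<in> U" for p using that open_subset[OF U] by blast
  have Z: "Z \<in> Obj A" using cone by (simp add: is_cone_preorder_category)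
  have \<psi>: "\<psi> p \<in> Hom A Z (OMap F (up p))" if "p \<in> U" for p
    using cone that UP by (simp add: is_cone_preorder_category OMap_stalks)
  have compat: "Comp A (AMap F (up q, up p)) (\<psi> p) = \<psi> q"
    if "p \<in> U" "(p, q) \<in> r" for p q
    using cone that open_upward[OF U that]
    by (simp add: is_cone_preorder_category flip: AMap_stalks)
  \<comment> \<open>Families are indexed by open sets, cones by points; equivalent points generate the same open set.\<close>
  define \<chi> where "\<chi> V = \<psi> (SOME p. p \<in> U \<and> up p = V)" for V
  have \<chi>: "\<chi> (up p) = \<psi> p" if p: "p \<in> U" for p
  proof -
    define q where "q = (SOME q. q \<in> U \<and> up q = up p)"
    have "q \<in> U \<and> up q = up p" unfolding q_def by (rule someI[of _ p]) (simp add: p)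
    then have q: "q \<in> U" "up q = up p" by auto
    then have "(q, p) \<in> r" using self_in_up[OF UP[OF p]] by (simp flip: in_up_iff)
    from compat[OF q(1) this] have "\<psi> q = \<psi> p"
      using A.Ident_Comp[OF \<psi>[OF q(1)]] by (simp add: q res_self open_up)
    then show ?thesis by (simp add: \<chi>_def q_def)
  qed
  have Union: "\<Union>(up ` U) = U"
    using up_subset[OF U] self_in_up UP by blast
  have "matching_family A F (up ` U) Z \<chi>"
    unfolding matching_family_def
  proof (intro conjI ballI Z)
    fix V assume "V \<in> up ` U"
    then show "\<chi> V \<in> Hom A Z (OMap F V)" using \<psi> \<chi> by auto
  next
    fix V W assume "V \<in> up ` U" "W \<in> up ` U"
    then obtain p q where p: "p \<in> U" "V = up p" and q: "q \<in> U" "W = up q" by blast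
    have VW: "openin X V" "openin X W" "openin X (V \<inter> W)" by (auto simp: p q open_up)
    have \<psi>p: "\<psi> p \<in> Hom A Z (OMap F V)" and \<psi>q: "\<psi> q \<in> Hom A Z (OMap F W)"
      using \<psi> p q by simp_all
    have "Comp A (AMap F (V \<inter> W, V)) (\<psi> p) = Comp A (AMap F (V \<inter> W, W)) (\<psi> q)"
    proof (rule glues_eqI[OF assms VW(3)])
      show "Comp A (AMap F (V \<inter> W, V)) (\<psi> p) \<in> Hom A Z (OMap F (V \<inter> W))"
        by (rule A.Comp_in[OF \<psi>p res_in[OF VW(1,3)]]) simp
      show "Comp A (AMap F (V \<inter> W, W)) (\<psi> q) \<in> Hom A Z (OMap F (V \<inter> W))"
        by (rule A.Comp_in[OF \<psi>q res_in[OF VW(2,3)]]) simp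
      fix x assume x: "x \<in> V \<inter> W"
      then have px: "(p, x) \<in> r" and qx: "(q, x) \<in> r" by (simp_all add: p q in_up_iff)
      have "Comp A (AMap F (up x, V \<inter> W)) (Comp A (AMap F (V \<inter> W, V)) (\<psi> p)) = \<psi> x"
        using res_res_comp[OF VW(1,3) open_up up_subset[OF VW(3) x] _ \<psi>p] compat[OF p(1) px]
        by (simp add: p)
      moreover have "Comp A (AMap F (up x, V \<inter> W)) (Comp A (AMap F (V \<inter> W, W)) (\<psi> q)) = \<psi> x"
        using res_res_comp[OF VW(2,3) open_up up_subset[OF VW(3) x] _ \<psi>q] compat[OF q(1) qx]
        by (simp add: q)
      ultimately show "Comp A (AMap F (up x, V \<inter> W)) (Comp A (AMap F (V \<inter> W, V)) (\<psi> p)) =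
          Comp A (AMap F (up x, V \<inter> W)) (Comp A (AMap F (V \<inter> W, W)) (\<psi> q))"
        by simp
    qed
    then show "Comp A (AMap F (V \<inter> W, V)) (\<chi> V) = Comp A (AMap F (V \<inter> W, W)) (\<chi> W)"
      using \<chi>[OF p(1)] \<chi>[OF q(1)] by (simp add: p(2) q(2))
  qed
  from glues_unique[OF glues _ this Union]
  have "\<exists>!h. h \<in> Hom A Z (OMap F U) \<and> (\<forall>V\<in>up ` U. Comp A (AMap F (V, U)) h = \<chi> V)"
    using open_up by blast
  then show "\<exists>!h. h \<in> Hom A Z (OMap F U) \<and>
      (\<forall>p\<in>Obj (sub U). Comp A (AMap F (up p, U)) h = \<psi> p)"
    by (simp add: \<chi> cong: ball_cong)
qed

text \<open>
  Conversely, a matching family on a cover of \<open>U\<close> has a well-defined restriction to the stalk at each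
  point of \<open>U\<close>, and these restrictions form a cone.
\<close>

lemma stalkwise_imp_glues:
  assumes "presheaf X A F" and stalkwise: "stalkwise F"
  shows "glues X A F"
  unfolding glues_def
proof (intro allI impI, elim conjE)
  fix \<U> Z \<psi> assume \<U>: "\<forall>V\<in>\<U>. openin X V" and match: "matching_family A F \<U> Z \<psi>"
  interpret presheaf X A F by fact
  let ?U = "\<Union>\<U>"
  have U: "openin X ?U" using \<U> by blast
  have Z: "Z \<in> Obj A" using match by (simp add: matching_family_def)
  have \<psi>: "\<psi> V \<in> Hom A Z (OMap F V)" if "V \<in> \<U>" for V
    using match that by (simp add: matching_family_def)
  \<comment> \<open>Matching makes the component at \<open>p\<close> independent of the chosen member \<open>c p\<close> of the cover around \<open>p\<close>.\<close>
  define c where "c p = (SOME V. V \<in> \<U> \<and> p \<in> V)" for p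
  have c: "c p \<in> \<U>" "p \<in> c p" if "p \<in> ?U" for p
    using that someI_ex[of "\<lambda>V. V \<in> \<U> \<and> p \<in> V"] by (auto simp: c_def)
  define \<chi> where "\<chi> p = Comp A (AMap F (up p, c p)) (\<psi> (c p))" for p
  have \<chi>: "Comp A (AMap F (up p, V)) (\<psi> V) = \<chi> p" if V: "V \<in> \<U>" and p: "p \<in> V" for p V
  proof -
    have W: "c p \<in> \<U>" "p \<in> c p" using c V p by blast+
    have VW: "openin X V" "openin X (c p)" "openin X (V \<inter> c p)" using \<U> V W(1) by auto
    have up: "up p \<subseteq> V \<inter> c p" using up_subset[OF VW(3)] p W by blast
    show ?thesis
      using matching_family_agree[OF match V W(1)]
        res_res_comp[OF VW(1,3) open_up up _ \<psi>[OF V]]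
        res_res_comp[OF VW(2,3) open_up up _ \<psi>[OF W(1)]]
      by (simp add: \<chi>_def)
  qed
  have \<chi>_in: "\<chi> p \<in> Hom A Z (OMap F (up p))" if "p \<in> ?U" for p
  proof -
    have V: "openin X (c p)" using \<U> c(1)[OF that] by blast
    show ?thesis
      unfolding \<chi>_def
      by (rule A.Comp_in[OF \<psi>[OF c(1)[OF that]] res_in[OF V open_up up_subset[OF V c(2)[OF that]]]])
  qed
  have "is_cone (sub ?U) A (stalks F) Z \<chi>"
    unfolding is_cone_preorder_category
  proof (intro conjI ballI allI impI Z)
    fix p assume "p \<in> ?U"
    then show "\<chi> p \<in> Hom A Z (OMap (stalks F) p)"
      using \<chi>_in[of p] subsetD[OF open_subset[OF U], of p] by (simp add: OMap_stalks)
  next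
    fix p q assume "(p, q) \<in> Restr r ?U"
    then have pq: "(p, q) \<in> r" "p \<in> ?U" by auto
    have V: "openin X (c p)" using \<U> c[OF pq(2)] by blast
    have "q \<in> c p" by (rule open_upward[OF V c(2)[OF pq(2)] pq(1)])
    from \<chi>[OF c(1)[OF pq(2)] this]
    show "Comp A (AMap (stalks F) (p, q)) (\<chi> p) = \<chi> q"
      using res_res_comp[OF V open_up open_up up_mono[OF pq(1)] up_subset[OF V c(2)[OF pq(2)]]
          \<psi>[OF c(1)[OF pq(2)]]]
      by (simp add: AMap_stalks pq(1) \<chi>_def[of p])
  qed
  then obtain h where h: "h \<in> Hom A Z (OMap F ?U)"
    and h\<chi>: "\<And>p. p \<in> ?U \<Longrightarrow> Comp A (AMap F (up p, ?U)) h = \<chi> p"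
    using limit_factorization[OF stalkwise[unfolded stalkwise_def, rule_format, OF U]] by blast
  show "\<exists>!h. h \<in> Hom A Z (OMap F ?U) \<and> (\<forall>V\<in>\<U>. Comp A (AMap F (V, ?U)) h = \<psi> V)"
  proof (rule ex1I[of _ h], intro conjI h ballI)
    fix V assume V: "V \<in> \<U>"
    then have V': "openin X V" "V \<subseteq> ?U" using \<U> by auto
    show "Comp A (AMap F (V, ?U)) h = \<psi> V"
    proof (rule stalkwise_eqI[OF assms V'(1) A.Comp_in[OF h res_in[OF U V']] \<psi>[OF V]])
      fix p assume p: "p \<in> V"
      show "Comp A (AMap F (up p, V)) (Comp A (AMap F (V, ?U)) h) =
            Comp A (AMap F (up p, V)) (\<psi> V)"
        using h\<chi>[OF subsetD[OF V'(2) p]]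
        by (simp add: res_res_comp[OF U V'(1) open_up up_subset[OF V'(1) p] V'(2) h] \<chi>[OF V p])
    qed
  next
    fix k assume "k \<in> Hom A Z (OMap F ?U) \<and> (\<forall>V\<in>\<U>. Comp A (AMap F (V, ?U)) k = \<psi> V)"
    then have k: "k \<in> Hom A Z (OMap F ?U)" and k\<psi>: "\<And>V. V \<in> \<U> \<Longrightarrow> Comp A (AMap F (V, ?U)) k = \<psi> V"
      by simp_all
    show "k = h"
    proof (rule stalkwise_eqI[OF assms U k h])
      fix p assume p: "p \<in> ?U"
      have V: "openin X (c p)" "c p \<subseteq> ?U" using \<U> c[OF p] by blast+
      have "Comp A (AMap F (up p, ?U)) k = \<chi> p"
        using res_res_comp[OF U V(1) open_up up_subset[OF V(1) c(2)[OF p]] V(2) k]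
          k\<psi>[OF c(1)[OF p]] by (simp add: \<chi>_def)
      then show "Comp A (AMap F (up p, ?U)) k = Comp A (AMap F (up p, ?U)) h"
        by (simp add: h\<chi>[OF p])
    qed
  qed
qed

lemma is_sheaf_iff_stalkwise:
  assumes "complete_category TYPE('u) A" and "infinite (UNIV :: 'u set)"
    and "{U. openin X U} \<lesssim> (UNIV :: 'u set)" and F: "presheaf X A F"
  shows "is_sheaf X A F \<longleftrightarrow> stalkwise F"
  using glues_imp_stalkwise[OF F is_sheaf_imp_glues[OF F]]
    glues_imp_is_sheaf[OF assms stalkwise_imp_glues[OF F]]
  by blast

section \<open>Natural transformations on stalks\<close>

lemma natural_transformation_stalks:
  assumes "presheaf X A F" "presheaf X A G"
    and \<eta>: "natural_transformation (opposite (opens_category X)) A F G \<eta>"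
  shows "natural_transformation (preorder_category P r) A (stalks F) (stalks G) (\<lambda>p\<in>P. \<eta> (up p))"
proof -
  interpret F: is_functor "preorder_category P r" A "stalks F" by (rule functor_stalks[OF assms(1)])
  interpret G: is_functor "preorder_category P r" A "stalks G" by (rule functor_stalks[OF assms(2)])
  interpret \<eta>: natural_transformation "opposite (opens_category X)" A F G \<eta> by fact
  show ?thesis
  proof
    fix p assume "p \<in> Obj (preorder_category P r)"
    then show "(\<lambda>p\<in>P. \<eta> (up p)) p \<in> Hom A (OMap (stalks F) p) (OMap (stalks G) p)"
      using \<eta>.component_in[of "up p"] by (simp add: OMap_stalks Obj_opposite_opens_category open_up)
  next
    fix f p q assume "f \<in> Hom (preorder_category P r) p q"
    then have pq: "f = (p, q)" "(p, q) \<in> r" by (simp_all add: Hom_preorder_category)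
    have "(up q, up p) \<in> Hom (opposite (opens_category X)) (up p) (up q)"
      by (simp add: Hom_opposite_opens_category open_up up_mono[OF pq(2)])
    from \<eta>.naturality[OF this] r_field[OF pq(2)]
    show "Comp A ((\<lambda>p\<in>P. \<eta> (up p)) q) (AMap (stalks F) f) =
          Comp A (AMap (stalks G) f) ((\<lambda>p\<in>P. \<eta> (up p)) p)"
      by (simp add: pq AMap_stalks)
  qed simp
qed

lemma naturality_at:
  assumes "natural_transformation (opposite (opens_category X)) A F G \<eta>"
    and U: "openin X U" and V: "openin X V" "V \<subseteq> U"
  shows "Comp A (\<eta> V) (AMap F (V, U)) = Comp A (AMap G (V, U)) (\<eta> U)"
  using natural_transformation.naturality[OF assms(1), of "(V, U)" U V] U V
  by (simp add: Hom_opposite_opens_category)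

text \<open>
  As \<open>G(U)\<close> is the limit of the stalks of \<open>G\<close>, the component at \<open>U\<close> is determined by its composites with
  the restrictions to the stalks, and by naturality these factor through the components at the stalks.
\<close>

lemma stalks_faithful:
  assumes "presheaf X A G" and "stalkwise G"
    and \<eta>: "natural_transformation (opposite (opens_category X)) A F G \<eta>"
    and \<theta>: "natural_transformation (opposite (opens_category X)) A F G \<theta>"
    and eq: "\<And>p. p \<in> P \<Longrightarrow> \<eta> (up p) = \<theta> (up p)"
  shows "\<eta> = \<theta>"
proof (rule natural_transformation_eqI[OF \<eta> \<theta>])
  fix U assume "U \<in> Obj (opposite (opens_category X))"
  then have U: "openin X U" by (simp add: Obj_opposite_opens_category)
  have in_Hom: "\<eta> U \<in> Hom A (OMap F U) (OMap G U)" "\<theta> U \<in> Hom A (OMap F U) (OMap G U)"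
    using natural_transformation.component_in[OF \<eta>, of U]
      natural_transformation.component_in[OF \<theta>, of U] U
    by (simp_all add: Obj_opposite_opens_category)
  show "\<eta> U = \<theta> U"
  proof (rule stalkwise_eqI[OF assms(1,2) U in_Hom])
    fix p assume p: "p \<in> U"
    then have "p \<in> P" using open_subset[OF U] by blast
    then show "Comp A (AMap G (up p, U)) (\<eta> U) = Comp A (AMap G (up p, U)) (\<theta> U)"
      using naturality_at[OF \<eta> U open_up up_subset[OF U p]]
        naturality_at[OF \<theta> U open_up up_subset[OF U p]] eq by simp
  qed
qed

text \<open>
  The composites of the restrictions of \<open>F\<close> with the given transformation form a cone over the stalks
  of \<open>G\<close>; the component at \<open>U\<close> is the arrow that this cone induces into the limit \<open>G(U)\<close>.
\<close>

lemma stalks_full: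
  assumes "presheaf X A F" "presheaf X A G" and "stalkwise G"
    and \<theta>: "natural_transformation (preorder_category P r) A (stalks F) (stalks G) \<theta>"
  obtains \<eta> where "natural_transformation (opposite (opens_category X)) A F G \<eta>"
    and "\<And>p. p \<in> P \<Longrightarrow> \<eta> (up p) = \<theta> p"
proof -
  interpret F: presheaf X A F by fact
  interpret G: presheaf X A G by fact
  interpret \<theta>: natural_transformation "preorder_category P r" A "stalks F" "stalks G" \<theta> by fact
  have \<theta>_in: "\<theta> p \<in> Hom A (OMap F (up p)) (OMap G (up p))" if "p \<in> P" for p
    using \<theta>.component_in[of p] that by (simp add: OMap_stalks)
  have \<theta>_nat: "Comp A (\<theta> q) (AMap F (up q, up p)) = Comp A (AMap G (up q, up p)) (\<theta> p)"
    if "(p, q) \<in> r" for p q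
    using \<theta>.naturality[of "(p, q)" p q] that by (simp add: Hom_preorder_category AMap_stalks)
  have "\<exists>h. h \<in> Hom A (OMap F U) (OMap G U) \<and>
      (\<forall>p\<in>U. Comp A (AMap G (up p, U)) h = Comp A (\<theta> p) (AMap F (up p, U)))"
    if U: "openin X U" for U
  proof -
    have "is_cone (sub U) A (stalks G) (OMap F U) (\<lambda>p. Comp A (\<theta> p) (AMap F (up p, U)))"
      unfolding is_cone_preorder_category
    proof (intro conjI ballI allI impI F.obj_in U)
      fix p assume p: "p \<in> U"
      then have "p \<in> P" using open_subset[OF U] by blast
      then show "Comp A (\<theta> p) (AMap F (up p, U)) \<in> Hom A (OMap F U) (OMap (stalks G) p)"
        using A.Comp_in[OF F.res_in[OF U open_up up_subset[OF U p]] \<theta>_in] by (simp add: OMap_stalks)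
    next
      fix p q assume pq: "(p, q) \<in> Restr r U"
      then have *: "(p, q) \<in> r" "p \<in> U" "q \<in> U" "p \<in> P" "q \<in> P" using r_field by auto
      note Fp = F.res_in[OF U open_up up_subset[OF U *(2)]]
      note Fpq = F.res_in[OF open_up open_up up_mono[OF *(1)]]
      note Gpq = G.res_in[OF open_up open_up up_mono[OF *(1)]]
      have "Comp A (AMap G (up q, up p)) (Comp A (\<theta> p) (AMap F (up p, U))) =
            Comp A (Comp A (\<theta> q) (AMap F (up q, up p))) (AMap F (up p, U))"
        by (simp add: A.Comp_assoc[OF Fp \<theta>_in[OF *(4)] Gpq] \<theta>_nat[OF *(1)])
      also have "\<dots> = Comp A (\<theta> q) (AMap F (up q, U))"
        using F.res_res[OF U open_up open_up up_mono[OF *(1)] up_subset[OF U *(2)]]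
        by (simp flip: A.Comp_assoc[OF Fp Fpq \<theta>_in[OF *(5)]])
      finally show "Comp A (AMap (stalks G) (p, q)) (Comp A (\<theta> p) (AMap F (up p, U))) =
                    Comp A (\<theta> q) (AMap F (up q, U))"
        by (simp add: AMap_stalks[OF *(1)])
    qed
    then obtain h where "h \<in> Hom A (OMap F U) (OMap G U)"
      and "\<And>p. p \<in> U \<Longrightarrow> Comp A (AMap G (up p, U)) h = Comp A (\<theta> p) (AMap F (up p, U))"
      using limit_factorization[OF assms(3)[unfolded stalkwise_def, rule_format, OF U]] by blast
    then show ?thesis by blast
  qed
  then obtain e where e: "\<And>U. openin X U \<Longrightarrow> e U \<in> Hom A (OMap F U) (OMap G U)"
    and e_stalk: "\<And>U p. \<lbrakk>openin X U; p \<in> U\<rbrakk>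
      \<Longrightarrow> Comp A (AMap G (up p, U)) (e U) = Comp A (\<theta> p) (AMap F (up p, U))"
    by metis
  define \<eta> where "\<eta> = restrict e {U. openin X U}"
  have \<eta>: "\<eta> U = e U" if "openin X U" for U using that by (simp add: \<eta>_def)
  have "natural_transformation (opposite (opens_category X)) A F G \<eta>"
  proof
    show "\<eta> \<in> extensional (Obj (opposite (opens_category X)))"
      by (simp add: \<eta>_def extensional_def Obj_opposite_opens_category)
  next
    fix U assume "U \<in> Obj (opposite (opens_category X))"
    then show "\<eta> U \<in> Hom A (OMap F U) (OMap G U)"
      by (simp add: Obj_opposite_opens_category \<eta> e)
  next
    fix f U V assume "f \<in> Hom (opposite (opens_category X)) U V"
    then have f: "f = (V, U)" and U: "openin X U" and V: "openin X V" "V \<subseteq> U"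
      by (simp_all add: Hom_opposite_opens_category)
    note FVU = F.res_in[OF U V] and GVU = G.res_in[OF U V]
    show "Comp A (\<eta> V) (AMap F f) = Comp A (AMap G f) (\<eta> U)"
      unfolding f \<eta>[OF U] \<eta>[OF V(1)]
    proof (rule stalkwise_eqI[OF assms(2,3) V(1) A.Comp_in[OF FVU e[OF V(1)]]
          A.Comp_in[OF e[OF U] GVU]])
      fix p assume p: "p \<in> V"
      then have pP: "p \<in> P" and pU: "p \<in> U" using V open_subset[OF U] by auto
      note pV = up_subset[OF V(1) p]
      have "Comp A (AMap G (up p, V)) (Comp A (e V) (AMap F (V, U))) =
            Comp A (Comp A (\<theta> p) (AMap F (up p, V))) (AMap F (V, U))"
        by (simp add: A.Comp_assoc[OF FVU e[OF V(1)] G.res_in[OF V(1) open_up pV]]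
            e_stalk[OF V(1) p])
      also have "\<dots> = Comp A (\<theta> p) (AMap F (up p, U))"
        by (simp add: F.res_res[OF U V(1) open_up pV V(2)]
            flip: A.Comp_assoc[OF FVU F.res_in[OF V(1) open_up pV] \<theta>_in[OF pP]])
      also have "\<dots> = Comp A (AMap G (up p, V)) (Comp A (AMap G (V, U)) (e U))"
        by (simp add: G.res_res_comp[OF U V(1) open_up pV V(2) e[OF U]] e_stalk[OF U pU])
      finally show "Comp A (AMap G (up p, V)) (Comp A (e V) (AMap F (V, U))) =
                    Comp A (AMap G (up p, V)) (Comp A (AMap G (V, U)) (e U))" .
    qed
  qed
  moreover have "\<eta> (up p) = \<theta> p" if p: "p \<in> P" for p
    unfolding \<eta>[OF open_up]
  proof (rule stalkwise_eqI[OF assms(2,3) open_up e[OF open_up] \<theta>_in[OF p]])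
    fix q assume "q \<in> up p"
    then have "(p, q) \<in> r" by (simp add: in_up_iff)
    then show "Comp A (AMap G (up q, up p)) (e (up p)) = Comp A (AMap G (up q, up p)) (\<theta> p)"
      using e_stalk[OF open_up \<open>q \<in> up p\<close>] \<theta>_nat by simp
  qed
  ultimately show thesis using that by blast
qed

section \<open>Every cellular sheaf consists of stalks of a sheaf\<close>

text \<open>
  The point \<open>p\<close> is initial in \<open>up p\<close>, and the limit of a diagram with an initial object is its value
  there.
\<close>

lemma principal_limit:
  assumes F: "is_functor (preorder_category P r) A F" and p: "p \<in> P"
  shows "is_limit (sub (up p)) A F (OMap F p) (\<lambda>q. AMap F (p, q))"
  unfolding is_limit_def
proof (intro conjI allI impI)
  interpret is_functor "preorder_category P r" A F by fact
  have F_in: "AMap F (p, q) \<in> Hom A (OMap F p) (OMap F q)" if "(p, q) \<in> r" for p q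
    using AMap_in[of "(p, q)" p q] that by (simp add: Hom_preorder_category)
  have F_comp: "Comp A (AMap F (q, x)) (AMap F (p, q)) = AMap F (p, x)"
    if "(p, q) \<in> r" "(q, x) \<in> r" for p q x
    using AMap_Comp[of "(p, q)" p q "(q, x)" x] that by (simp add: Hom_preorder_category)
  have F_id: "AMap F (p, p) = Ident A (OMap F p)"
    using AMap_Ident[of p] p by simp
  show "is_cone (sub (up p)) A F (OMap F p) (\<lambda>q. AMap F (p, q))"
    using OMap_in[of p] p F_in F_comp by (auto simp: is_cone_preorder_category in_up_iff)
  fix Z \<psi> assume cone: "is_cone (sub (up p)) A F Z \<psi>"
  have pp: "(p, p) \<in> r" by (rule r_refl[OF p])
  have \<psi>p: "\<psi> p \<in> Hom A Z (OMap F p)"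
    using cone pp by (simp add: is_cone_preorder_category in_up_iff)
  show "\<exists>!h. h \<in> Hom A Z (OMap F p) \<and> (\<forall>q\<in>Obj (sub (up p)). Comp A (AMap F (p, q)) h = \<psi> q)"
  proof (rule ex1I[of _ "\<psi> p"])
    show "\<psi> p \<in> Hom A Z (OMap F p) \<and> (\<forall>q\<in>Obj (sub (up p)). Comp A (AMap F (p, q)) (\<psi> p) = \<psi> q)"
      using cone pp by (simp add: is_cone_preorder_category in_up_iff)
  next
    fix h assume "h \<in> Hom A Z (OMap F p) \<and> (\<forall>q\<in>Obj (sub (up p)). Comp A (AMap F (p, q)) h = \<psi> q)"
    then have "h \<in> Hom A Z (OMap F p)" "Comp A (AMap F (p, p)) h = \<psi> p"
      using pp by (simp_all add: in_up_iff)
    then show "h = \<psi> p" using A.Ident_Comp by (simp add: F_id)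
  qed
qed

text \<open>
  The limit over \<open>up p\<close> is to be \<open>F(p)\<close> itself. This is where cellularity enters: if \<open>up p = up q\<close>, then
  \<open>p\<close> and \<open>q\<close> are equivalent, and a cellular \<open>F\<close> gives the same limit cone at both.
\<close>

lemma normalized_limit_exists:
  assumes complete: "complete_category TYPE('u) A" and inf: "infinite (UNIV :: 'u set)"
    and small: "P \<lesssim> (UNIV :: 'u set)"
    and F: "is_functor (preorder_category P r) A F" and cellular: "is_cellular_sheaf r A F"
    and U: "openin X U"
  shows "\<exists>L \<phi>. is_limit (sub U) A F L \<phi> \<and>
     (\<forall>p\<in>P. U = up p \<longrightarrow> L = OMap F p \<and> (\<forall>q\<in>U. \<phi> q = AMap F (p, q)))"
proof (cases "\<exists>p\<in>P. U = up p")
  case True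
  then obtain p where p: "p \<in> P" "U = up p" by blast
  interpret is_functor "preorder_category P r" A F by fact
  have "OMap F p = OMap F q \<and> (\<forall>x\<in>U. AMap F (p, x) = AMap F (q, x))" if q: "q \<in> P" "U = up q" for q
  proof -
    have "q \<in> up p" "p \<in> up q" using p q self_in_up by auto
    then have pq: "(p, q) \<in> r" "(q, p) \<in> r" by (simp_all add: in_up_iff)
    have "OMap F p = OMap F q \<and>
        AMap F (p, q) = Ident A (OMap F p) \<and> AMap F (q, p) = Ident A (OMap F p)"
      using cellular[unfolded is_cellular_sheaf_def, rule_format, OF conjI[OF pq]] .
    then have *: "OMap F p = OMap F q" "AMap F (p, q) = Ident A (OMap F q)" by simp_all
    have "AMap F (p, x) = AMap F (q, x)" if "x \<in> U" for x
    proof -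
      have qx: "(q, x) \<in> r" using that q(2) by (simp add: in_up_iff)
      then have "AMap F (q, x) \<in> Hom A (OMap F q) (OMap F x)"
        using AMap_in[of "(q, x)" q x] by (simp add: Hom_preorder_category)
      from A.Comp_Ident[OF this] show ?thesis
        using AMap_Comp[of "(p, q)" p q "(q, x)" x] pq qx
        by (simp add: Hom_preorder_category *(2))
    qed
    with * show ?thesis by blast
  qed
  then have "\<forall>q\<in>P. U = up q \<longrightarrow> OMap F p = OMap F q \<and> (\<forall>x\<in>U. AMap F (p, x) = AMap F (q, x))"
    by blast
  with principal_limit[OF F p(1), folded p(2)] show ?thesis by blast
next
  case False
  interpret is_functor "preorder_category P r" A F by fact
  have UP: "U \<subseteq> P" by (rule open_subset[OF U])
  have "\<exists>L \<phi>. is_limit (sub U) A F L \<phi>"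
  proof (rule preorder_limit_exists[OF complete inf preorder_on_Restr[OF UP]])
    show "U \<lesssim> (UNIV :: 'u set)" using lepoll_trans[OF subset_imp_lepoll[OF UP] small] .
    show "OMap F p \<in> Obj A" "AMap F (p, p) = Ident A (OMap F p)" if "p \<in> U" for p
      using that UP OMap_in[of p] AMap_Ident[of p] by auto
    show "AMap F (p, q) \<in> Hom A (OMap F p) (OMap F q)" if "(p, q) \<in> Restr r U" for p q
      using AMap_in[of "(p, q)" p q] that by (simp add: Hom_preorder_category)
    show "AMap F (p, x) = Comp A (AMap F (q, x)) (AMap F (p, q))"
      if "(p, q) \<in> Restr r U" "(q, x) \<in> Restr r U" for p q x
      using AMap_Comp[of "(p, q)" p q "(q, x)" x] that by (simp add: Hom_preorder_category)
  qed
  with False show ?thesis by blast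
qed

lemma is_limit_cong_cone:
  assumes "is_limit (sub U) A F L \<phi>" and "\<And>p. p \<in> U \<Longrightarrow> \<phi> p = \<psi> p"
  shows "is_limit (sub U) A F L \<psi>"
  using assms by (simp add: is_limit_def is_cone_preorder_category)

text \<open>
  The sheaf is \<open>U \<mapsto> lim F\<close>, with the induced arrows as restrictions. With the normalized choice of
  limits, the restriction to \<open>up p\<close> is the component at \<open>p\<close> of the limit cone (\<open>\<rho>_up\<close> in the proof),
  so the stalks are those of \<open>F\<close> on the nose and the limits over \<open>F\<close> are limits over the stalks.
\<close>

lemma stalks_surjective:
  assumes complete: "complete_category TYPE('u) A" and inf: "infinite (UNIV :: 'u set)"
    and small: "P \<lesssim> (UNIV :: 'u set)"
    and F: "is_functor (preorder_category P r) A F" and cellular: "is_cellular_sheaf r A F"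
  obtains G where "presheaf X A G" "stalkwise G" "stalks G = F"
proof -
  interpret is_functor "preorder_category P r" A F by fact
  have F_in: "AMap F (p, q) \<in> Hom A (OMap F p) (OMap F q)" if "(p, q) \<in> r" for p q
    using AMap_in[of "(p, q)" p q] that by (simp add: Hom_preorder_category)
  have F_id: "AMap F (p, p) = Ident A (OMap F p)" if "p \<in> P" for p
    using AMap_Ident[of p] that by simp
  have "\<forall>U\<in>{U. openin X U}. \<exists>c. is_limit (sub U) A F (fst c) (snd c) \<and>
     (\<forall>p\<in>P. U = up p \<longrightarrow> fst c = OMap F p \<and> (\<forall>q\<in>U. snd c q = AMap F (p, q)))"
    using normalized_limit_exists[OF assms(1-5)] by simp
  from bchoice[OF this] obtain c where c: "\<forall>U\<in>{U. openin X U}.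
     is_limit (sub U) A F (fst (c U)) (snd (c U)) \<and>
     (\<forall>p\<in>P. U = up p \<longrightarrow> fst (c U) = OMap F p \<and> (\<forall>q\<in>U. snd (c U) q = AMap F (p, q)))"
    by (elim exE)
  define L where "L U = fst (c U)" for U
  define \<phi> where "\<phi> U = snd (c U)" for U
  have L: "is_limit (sub U) A F (L U) (\<phi> U)" if "openin X U" for U
    using bspec[OF c, of U] that by (simp add: L_def \<phi>_def)
  have L_up: "L (up p) = OMap F p" and \<phi>_up: "\<And>q. (p, q) \<in> r \<Longrightarrow> \<phi> (up p) q = AMap F (p, q)"
    if "p \<in> P" for p
    using bspec[OF c, of "up p"] that open_up by (simp_all add: L_def \<phi>_def in_up_iff)
  have \<phi>: "\<phi> U p \<in> Hom A (L U) (OMap F p)" if "openin X U" "p \<in> U" for U p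
    by (rule limit_cone_in_Hom[OF L[OF that(1)] that(2)])
  have L_Obj: "L U \<in> Obj A" if "openin X U" for U
    using L[OF that] by (simp add: is_limit_def is_cone_preorder_category)
  have L_eqI: "h = h'" if "openin X U" "h \<in> Hom A Z (L U)" "h' \<in> Hom A Z (L U)"
    "\<And>p. p \<in> U \<Longrightarrow> Comp A (\<phi> U p) h = Comp A (\<phi> U p) h'" for U Z h h'
    by (rule limit_arrow_eqI[OF category L[OF that(1)] _ _ that(2-4)]) (auto simp: F_in)
  define \<rho> where "\<rho> V U = (SOME h. h \<in> Hom A (L U) (L V) \<and>
      (\<forall>p\<in>V. Comp A (\<phi> V p) h = \<phi> U p))" for V U
  have \<rho>: "\<rho> V U \<in> Hom A (L U) (L V)"
    and \<phi>\<rho>: "\<And>p. p \<in> V \<Longrightarrow> Comp A (\<phi> V p) (\<rho> V U) = \<phi> U p"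
    if U: "openin X U" and V: "openin X V" "V \<subseteq> U" for U V
  proof -
    have "is_cone (sub V) A F (L U) (\<phi> U)"
      unfolding is_cone_preorder_category
      using V(2) by (auto intro: L_Obj[OF U] \<phi>[OF U] limit_cone_compatible[OF L[OF U]])
    from limit_factorization[OF L[OF V(1)] this]
    obtain h where "h \<in> Hom A (L U) (L V)" "\<And>p. p \<in> V \<Longrightarrow> Comp A (\<phi> V p) h = \<phi> U p"
      by blast
    then have "\<exists>h. h \<in> Hom A (L U) (L V) \<and> (\<forall>p\<in>V. Comp A (\<phi> V p) h = \<phi> U p)"
      by (intro exI[of _ h] conjI ballI)
    then have "\<rho> V U \<in> Hom A (L U) (L V) \<and> (\<forall>p\<in>V. Comp A (\<phi> V p) (\<rho> V U) = \<phi> U p)"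
      unfolding \<rho>_def by (rule someI_ex)
    then show "\<rho> V U \<in> Hom A (L U) (L V)"
      and "\<And>p. p \<in> V \<Longrightarrow> Comp A (\<phi> V p) (\<rho> V U) = \<phi> U p"
      by simp_all
  qed
  define G where "G = \<lparr>OMap = restrict L (Obj (opposite (opens_category X))),
     AMap = restrict (\<lambda>(V, U). \<rho> V U) (Arr (opposite (opens_category X)))\<rparr>"
  have G_Obj: "OMap G U = L U" if "openin X U" for U
    using that by (simp add: G_def Obj_opposite_opens_category)
  have G_Arr: "AMap G (V, U) = \<rho> V U" if "openin X U" "openin X V" "V \<subseteq> U" for U V
    using that by (simp add: G_def Arr_opposite_opens_category)
  interpret O: category "opposite (opens_category X)" by (rule category_opposite_opens_category)
  have "is_functor (opposite (opens_category X)) A G"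
  proof
    fix U assume "U \<in> Obj (opposite (opens_category X))"
    then have U: "openin X U" by (simp add: Obj_opposite_opens_category)
    show "OMap G U \<in> Obj A" by (simp add: G_Obj U L_Obj)
    have Ident: "Ident (opposite (opens_category X)) U = (U, U)"
      by (simp add: opposite_def opens_category_def)
    have "\<rho> U U = Ident A (L U)"
      by (rule L_eqI[OF U \<rho>[OF U U order_refl] A.Ident_in[OF L_Obj[OF U]]])
         (simp add: \<phi>\<rho>[OF U U order_refl] A.Comp_Ident[OF \<phi>[OF U]])
    then show "AMap G (Ident (opposite (opens_category X)) U) = Ident A (OMap G U)"
      by (simp add: Ident G_Arr G_Obj U)
  next
    fix f U V assume "f \<in> Hom (opposite (opens_category X)) U V"
    then show "AMap G f \<in> Hom A (OMap G U) (OMap G V)"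
      by (auto simp: Hom_opposite_opens_category G_Arr G_Obj \<rho>)
  next
    fix f g U V W
    assume "f \<in> Hom (opposite (opens_category X)) U V" "g \<in> Hom (opposite (opens_category X)) V W"
    then have f: "f = (V, U)" and g: "g = (W, V)"
      and o: "openin X U" "openin X V" "openin X W" and sub: "V \<subseteq> U" "W \<subseteq> V" "W \<subseteq> U"
      by (auto simp: Hom_opposite_opens_category)
    have Comp: "Comp (opposite (opens_category X)) g f = (W, U)"
      by (simp add: f g opposite_def opens_category_def)
    have "\<rho> W U = Comp A (\<rho> W V) (\<rho> V U)"
    proof (rule L_eqI[OF o(3) \<rho>[OF o(1,3) sub(3)]
          A.Comp_in[OF \<rho>[OF o(1,2) sub(1)] \<rho>[OF o(2,3) sub(2)]]])
      fix p assume p: "p \<in> W"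
      then have pV: "p \<in> V" using sub by blast
      show "Comp A (\<phi> W p) (\<rho> W U) = Comp A (\<phi> W p) (Comp A (\<rho> W V) (\<rho> V U))"
        by (simp add: A.Comp_assoc[OF \<rho>[OF o(1,2) sub(1)] \<rho>[OF o(2,3) sub(2)] \<phi>[OF o(3) p]]
            \<phi>\<rho>[OF o(1,3) sub(3) p] \<phi>\<rho>[OF o(2,3) sub(2) p] \<phi>\<rho>[OF o(1,2) sub(1) pV])
    qed
    then show "AMap G (Comp (opposite (opens_category X)) g f) = Comp A (AMap G g) (AMap G f)"
      unfolding Comp by (simp add: f g G_Arr o sub)
  qed (simp_all add: G_def)
  then have G: "presheaf X A G" by (simp add: presheaf_def)
  have \<rho>_up: "\<rho> (up p) U = \<phi> U p" if U: "openin X U" and p: "p \<in> U" for U p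
  proof -
    have pP: "p \<in> P" using p open_subset[OF U] by blast
    have "\<rho> (up p) U \<in> Hom A (L U) (OMap F p)"
      using \<rho>[OF U open_up up_subset[OF U p]] by (simp add: L_up[OF pP])
    from A.Ident_Comp[OF this] show ?thesis
      using \<phi>\<rho>[OF U open_up up_subset[OF U p] self_in_up[OF pP]]
      by (simp add: \<phi>_up[OF pP r_refl[OF pP]] F_id[OF pP])
  qed
  have "OMap (stalks G) = OMap F"
    by (rule extensionalityI[of _ P])
       (use OMap_ext in \<open>auto simp: stalks_def G_Obj open_up L_up\<close>)
  moreover have "AMap (stalks G) = AMap F"
  proof (rule extensionalityI[of _ r])
    fix f assume "f \<in> r"
    then obtain p q where pq: "f = (p, q)" "(p, q) \<in> r" by (cases f) auto
    have "p \<in> P" using r_field[OF pq(2)] by blast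
    then show "AMap (stalks G) f = AMap F f"
      using \<rho>_up[OF open_up, of q p] pq
      by (simp add: AMap_stalks G_Arr open_up up_mono in_up_iff \<phi>_up)
  qed (use AMap_ext in \<open>simp_all add: stalks_def\<close>)
  ultimately have stalks: "stalks G = F" by simp
  have "stalkwise G"
    unfolding stalkwise_def stalks
  proof (intro allI impI)
    fix U assume U: "openin X U"
    have "is_limit (sub U) A F (L U) (\<lambda>p. AMap G (up p, U))"
      by (rule is_limit_cong_cone[OF L[OF U]]) (simp add: G_Arr U open_up up_subset \<rho>_up)
    then show "is_limit (sub U) A F (OMap G U) (\<lambda>p. AMap G (up p, U))"
      by (simp add: G_Obj U)
  qed
  from that[OF G this stalks] show thesis .
qed

section \<open>The equivalence\<close>

definition stalk_functor where
  "stalk_functor =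
     \<lparr>OMap = restrict stalks (Obj (Sh X A)),
      AMap = restrict (\<lambda>(F, \<eta>, G). (stalks F, \<lambda>p\<in>P. \<eta> (up p), stalks G)) (Arr (Sh X A))\<rparr>"

lemma Obj_Sh: "F \<in> Obj (Sh X A) \<longleftrightarrow> presheaf X A F \<and> is_sheaf X A F"
  by (simp add: Sh_def full_subcategory_def functor_category_def presheaf_def)

lemma Hom_Sh:
  "f \<in> Hom (Sh X A) F G \<longleftrightarrow> is_sheaf X A F \<and> is_sheaf X A G \<and>
     (\<exists>\<eta>. f = (F, \<eta>, G) \<and> natural_transformation (opposite (opens_category X)) A F G \<eta>)"
  by (auto simp: Sh_def Hom_full_subcategory Hom_functor_category)

lemma Obj_Cell:
  "F \<in> Obj (Cell P r A) \<longleftrightarrow> is_functor (preorder_category P r) A F \<and> is_cellular_sheaf r A F"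
  by (simp add: Cell_def full_subcategory_def functor_category_def)

lemma Hom_Cell:
  "f \<in> Hom (Cell P r A) F G \<longleftrightarrow> is_cellular_sheaf r A F \<and> is_cellular_sheaf r A G \<and>
     (\<exists>\<eta>. f = (F, \<eta>, G) \<and> natural_transformation (preorder_category P r) A F G \<eta>)"
  by (auto simp: Cell_def Hom_full_subcategory Hom_functor_category)

lemma AMap_stalk_functor:
  assumes "(F, \<eta>, G) \<in> Hom (Sh X A) F G"
  shows "AMap stalk_functor (F, \<eta>, G) = (stalks F, \<lambda>p\<in>P. \<eta> (up p), stalks G)"
  using assms by (simp add: stalk_functor_def Hom_def)

lemma presheaf_if_natural_transformation:
  assumes "natural_transformation (opposite (opens_category X)) A F G \<eta>"
  shows "presheaf X A F" "presheaf X A G"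
  using assms by (simp_all add: natural_transformation_def presheaf_def)

lemma functor_stalk_functor: "is_functor (Sh X A) (Cell P r A) stalk_functor"
proof -
  interpret Sh: category "Sh X A"
    unfolding Sh_def by (intro category_full_subcategory category_functor_category)
  interpret Cell: category "Cell P r A"
    unfolding Cell_def by (intro category_full_subcategory category_functor_category)
  show ?thesis
  proof
    fix F assume F: "F \<in> Obj (Sh X A)"
    then have F': "presheaf X A F" by (simp add: Obj_Sh)
    show "OMap stalk_functor F \<in> Obj (Cell P r A)"
      using F by (simp add: stalk_functor_def Obj_Cell functor_stalks[OF F'] cellular_stalks[OF F'])
    have "Ident (Sh X A) F = (F, \<lambda>U\<in>Obj (opposite (opens_category X)). Ident A (OMap F U), F)"
      by (simp add: Sh_def full_subcategory_def functor_category_def)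
    then show "AMap stalk_functor (Ident (Sh X A) F) =
               Ident (Cell P r A) (OMap stalk_functor F)"
      using Sh.Ident_in[OF F] AMap_stalk_functor[of F _ F] F
      by (auto simp: Cell_def full_subcategory_def functor_category_def stalk_functor_def
          OMap_stalks Obj_opposite_opens_category open_up intro!: restrict_ext)
  next
    fix f F G assume f: "f \<in> Hom (Sh X A) F G"
    then obtain \<eta> where \<eta>: "f = (F, \<eta>, G)"
      "natural_transformation (opposite (opens_category X)) A F G \<eta>"
      by (auto simp: Hom_Sh)
    note FG = presheaf_if_natural_transformation[OF \<eta>(2)]
    have "F \<in> Obj (Sh X A)" "G \<in> Obj (Sh X A)"
      using f FG by (simp_all add: Hom_Sh Obj_Sh)
    then show "AMap stalk_functor f \<in> Hom (Cell P r A) (OMap stalk_functor F) (OMap stalk_functor G)"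
      using AMap_stalk_functor[of F \<eta> G] f natural_transformation_stalks[OF FG \<eta>(2)]
      by (simp add: \<eta>(1) Hom_Cell cellular_stalks FG stalk_functor_def)
  next
    fix f g F G H assume f: "f \<in> Hom (Sh X A) F G" and g: "g \<in> Hom (Sh X A) G H"
    obtain \<eta> where \<eta>: "f = (F, \<eta>, G)" using f by (auto simp: Hom_Sh)
    obtain \<theta> where \<theta>: "g = (G, \<theta>, H)" using g by (auto simp: Hom_Sh)
    have gf: "Comp (Sh X A) g f =
        (F, \<lambda>U\<in>Obj (opposite (opens_category X)). Comp A (\<theta> U) (\<eta> U), H)"
      by (simp add: \<eta> \<theta> Sh_def full_subcategory_def functor_category_def)
    have "AMap stalk_functor (Comp (Sh X A) g f) =
        (stalks F, \<lambda>p\<in>P. Comp A (\<theta> (up p)) (\<eta> (up p)), stalks H)"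
      using AMap_stalk_functor[OF Sh.Comp_in[OF f g, unfolded gf]]
      by (simp add: gf Obj_opposite_opens_category open_up cong: restrict_cong)
    also have "\<dots> = Comp (Cell P r A) (AMap stalk_functor g) (AMap stalk_functor f)"
      using AMap_stalk_functor[OF f[unfolded \<eta>]] AMap_stalk_functor[OF g[unfolded \<theta>]]
      by (simp add: \<eta> \<theta> Cell_def full_subcategory_def functor_category_def cong: restrict_cong)
    finally show "AMap stalk_functor (Comp (Sh X A) g f) =
        Comp (Cell P r A) (AMap stalk_functor g) (AMap stalk_functor f)" .
  qed (simp_all add: stalk_functor_def)
qed

end

theorem proposition2p4:
  fixes P :: "'p set" and r :: "'p rel" and A :: "('o, 'm) cat"
  assumes "preorder_on P r"
    and "infinite (UNIV :: 'u set)" and "Pow P \<lesssim> (UNIV :: 'u set)"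
    and "complete_category TYPE('u) A"
  shows "equivalent_categories (Cell P r A) (Sh (alexandrov P r) A)"
proof -
  interpret alexandrov_space P r A
    using assms by (simp add: alexandrov_space_def complete_category_def)
  have "{U. openin X U} \<subseteq> Pow P" using open_subset by blast
  then have small_opens: "{U. openin X U} \<lesssim> (UNIV :: 'u set)"
    by (rule lepoll_trans[OF subset_imp_lepoll assms(3)])
  have small_P: "P \<lesssim> (UNIV :: 'u set)"
    by (rule lepoll_trans[OF lepoll_Pow_self assms(3)])
  note Sh_stalkwise = is_sheaf_iff_stalkwise[OF assms(4,2) small_opens]
  have OMap: "OMap stalk_functor F = stalks F" if "F \<in> Obj (Sh X A)" for F
    using that by (simp add: stalk_functor_def)
  show ?thesis
  proof (rule equivalent_categories_if_fully_faithful_surjective[OF functor_stalk_functor])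
    show "Obj (Cell P r A) \<subseteq> OMap stalk_functor ` Obj (Sh X A)"
    proof
      fix F assume "F \<in> Obj (Cell P r A)"
      then obtain G where "presheaf X A G" "stalkwise G" "stalks G = F"
        using stalks_surjective[OF assms(4,2) small_P] by (auto simp: Obj_Cell)
      then have "G \<in> Obj (Sh X A)" "OMap stalk_functor G = F"
        by (simp_all add: Obj_Sh Sh_stalkwise OMap)
      then show "F \<in> OMap stalk_functor ` Obj (Sh X A)" by blast
    qed
  next
    fix F G assume F: "F \<in> Obj (Sh X A)" and G: "G \<in> Obj (Sh X A)"
    then have pre: "presheaf X A F" "presheaf X A G" and G': "stalkwise G"
      by (auto simp: Obj_Sh Sh_stalkwise)
    show "bij_betw (AMap stalk_functor) (Hom (Sh X A) F G)
            (Hom (Cell P r A) (OMap stalk_functor F) (OMap stalk_functor G))"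
      unfolding bij_betw_def
    proof
      show "inj_on (AMap stalk_functor) (Hom (Sh X A) F G)"
      proof (rule inj_onI)
        fix f g assume f: "f \<in> Hom (Sh X A) F G" and g: "g \<in> Hom (Sh X A) F G"
          and eq: "AMap stalk_functor f = AMap stalk_functor g"
        obtain \<eta> where \<eta>: "f = (F, \<eta>, G)"
          "natural_transformation (opposite (opens_category X)) A F G \<eta>"
          using f by (auto simp: Hom_Sh)
        obtain \<theta> where \<theta>: "g = (F, \<theta>, G)"
          "natural_transformation (opposite (opens_category X)) A F G \<theta>"
          using g by (auto simp: Hom_Sh)
        have "(\<lambda>p\<in>P. \<eta> (up p)) = (\<lambda>p\<in>P. \<theta> (up p))"
          using AMap_stalk_functor[OF f[unfolded \<eta>]] AMap_stalk_functor[OF g[unfolded \<theta>]] eq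
          by (simp add: \<eta>(1) \<theta>(1))
        then have "\<eta> (up p) = \<theta> (up p)" if "p \<in> P" for p
          using that by (metis restrict_apply')
        then show "f = g"
          using stalks_faithful[OF pre(2) G' \<eta>(2) \<theta>(2)] by (simp add: \<eta>(1) \<theta>(1))
      qed
      show "AMap stalk_functor ` Hom (Sh X A) F G =
            Hom (Cell P r A) (OMap stalk_functor F) (OMap stalk_functor G)"
      proof
        show "AMap stalk_functor ` Hom (Sh X A) F G
            \<subseteq> Hom (Cell P r A) (OMap stalk_functor F) (OMap stalk_functor G)"
          using is_functor.AMap_in[OF functor_stalk_functor] by blast
        show "Hom (Cell P r A) (OMap stalk_functor F) (OMap stalk_functor G)
            \<subseteq> AMap stalk_functor ` Hom (Sh X A) F G"
        proof
          fix t assume "t \<in> Hom (Cell P r A) (OMap stalk_functor F) (OMap stalk_functor G)"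
          then obtain \<theta> where t: "t = (stalks F, \<theta>, stalks G)" and
            \<theta>: "natural_transformation (preorder_category P r) A (stalks F) (stalks G) \<theta>"
            by (auto simp: Hom_Cell OMap F G)
          obtain \<eta> where \<eta>: "natural_transformation (opposite (opens_category X)) A F G \<eta>"
            and \<eta>_up: "\<And>p. p \<in> P \<Longrightarrow> \<eta> (up p) = \<theta> p"
            using stalks_full[OF pre G' \<theta>] by blast
          have f: "(F, \<eta>, G) \<in> Hom (Sh X A) F G"
            using F G \<eta> by (simp add: Hom_Sh Obj_Sh)
          have "(\<lambda>p\<in>P. \<eta> (up p)) = \<theta>"
            by (rule extensionalityI[of _ P])
               (use natural_transformation.component_ext[OF \<theta>] in \<open>simp_all add: \<eta>_up\<close>)
          then have "AMap stalk_functor (F, \<eta>, G) = t"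
            by (simp add: AMap_stalk_functor[OF f] t)
          with f show "t \<in> AMap stalk_functor ` Hom (Sh X A) F G" by blast
        qed
      qed
    qed
  qed
qed

end
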